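(* For every countable ordinal $\alpha<\omega_1$ there exists a small, $nm$-stable compact $G$-group $(H,G)$ such that $\mathcal{NM}(H)=\alpha$ and $H$ is abelian. Moreover, $H$ has an ascending sequence $(H_i)_{i\le\alpha}$ of $\emptyset$-closed subgroups such that $H_i$ is a nowhere dense subset of $H_j$ whenever $i<j\le\alpha$.
   Context: A Polish structure is a pair $(X,G)$ where $G$ is a Polish group acting faithfully on a set $X$ such that stabilizers of singletons are closed subgroups of $G$. It is small if for every $n\in\omega$ there are only countably many $G$-orbits on $X^n$. A compact $G$-group is a Polish structure $(H,G)$ where $H$ is a compact (Hausdorff) group and $G$ acts continuously on $H$ by group automorphisms. For finite $A\subseteq X$ and a finite tuple $a$, $G_A$ is the pointwise stabilizer of $A$ and $o(a/A)=\{ga:g\in G_A\}$. For finite $A,B$, $a$ is $nm$-independent from $B$ over $A$ if, with $\pi_A:G_A\to o(a/A)$, $\pi_A(g)=ga$, the set $\pi_A^{-1}[o(a/AB)]$ is non-meager in $\pi_A^{-1}[o(a/A)]$; otherwise $a$ is $nm$-dependent on $B$ over $A$. The $\mathcal{NM}$-rank is the unique function from orbits over finite sets to ordinals or $\infty$ such that $\mathcal{NM}(a/A)\ge\alpha+1$ iff there is a finite $B\supseteq A$ with $a$ $nm$-dependent on $B$ over $A$ and $\mathcal{NM}(a/B)\ge\alpha$ (usual convention at limits). $\mathcal{NM}(H)=\sup_{h\in H}\mathcal{NM}(h/\emptyset)$; the structure is $nm$-stable if this is $<\infty$. A subset of $H$ is $\emptyset$-closed if it is closed and invariant under all of $G$.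 *)

theory Defs
  imports "HOL-Analysis.Analysis" "HOL-Algebra.Group_Action"
begin

section \<open>Ordinals\<close>

quotient_type 'a ordinal = "'a rel" / partial: "\<lambda>r s. (r, s) \<in> ordIso"
proof (rule part_equivpI)
  show "\<exists>r :: 'a rel. (r, r) \<in> ordIso"
    by (rule exI[of _ "{}"]) (simp add: ordIso_reflexive)
  show "symp (\<lambda>r s :: 'a rel. (r, s) \<in> ordIso)"
    by (simp add: symp_def ordIso_symmetric)
  show "transp (\<lambda>r s :: 'a rel. (r, s) \<in> ordIso)"
    by (meson transpI ordIso_transitive)
qed

text \<open>
  The elements of \<^typ>\<open>'a ordinal\<close> are the isomorphism types of well-orders on subsets of
  \<^typ>\<open>'a\<close>, i.e. all ordinals of cardinality at most that of \<^typ>\<open>'a\<close>; the set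
  \<open>{..<\<alpha>}\<close> has order type \<open>\<alpha>\<close>.
\<close>

instantiation ordinal :: (type) linorder
begin

lift_definition less_eq_ordinal :: "'a ordinal \<Rightarrow> 'a ordinal \<Rightarrow> bool"
  is "\<lambda>r s. (r, s) \<in> ordLeq"
  by (meson ordIso_ordLeq_trans ordIso_symmetric ordLeq_ordIso_trans)

lift_definition less_ordinal :: "'a ordinal \<Rightarrow> 'a ordinal \<Rightarrow> bool"
  is "\<lambda>r s. (r, s) \<in> ordLess"
  by (meson ordIso_ordLess_trans ordIso_symmetric ordLess_ordIso_trans)

instance
proof
  fix x y z :: "'a ordinal"
  show "x < y \<longleftrightarrow> x \<le> y \<and> \<not> y \<le> x"
    by transfer (metis not_ordLess_ordLeq not_ordLeq_iff_ordLess ordIso_iff_ordLeq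
        ordLeq_Well_order_simp ordLess_imp_ordLeq)
  show "x \<le> x"
    by transfer (simp add: ordIso_imp_ordLeq)
  show "x \<le> y \<Longrightarrow> y \<le> z \<Longrightarrow> x \<le> z"
    by transfer (rule ordLeq_transitive)
  show "x \<le> y \<Longrightarrow> y \<le> x \<Longrightarrow> x = y"
    by transfer (simp add: ordIso_iff_ordLeq)
  show "x \<le> y \<or> y \<le> x"
    by transfer (meson ordIso_iff_ordLeq ordLeq_Well_order_simp ordLeq_total)
qed

end

instance ordinal :: (type) wellorder
proof
  fix P :: "'a ordinal \<Rightarrow> bool" and a :: "'a ordinal"
  assume step: "\<And>x. (\<And>y. y < x \<Longrightarrow> P y) \<Longrightarrow> P x"
  have P_abs: "P (abs_ordinal r)" if "Well_order r" for r :: "'a rel"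
    using that
  proof (induction r rule: wf_induct_rule[OF wf_ordLess])
    case (1 r)
    show ?case
    proof (rule step)
      fix y assume "y < abs_ordinal r"
      then have "(rep_ordinal y, r) \<in> ordLess"
        using Quotient_rep_abs[OF Quotient_ordinal, of r] 1(2)
        by (metis less_ordinal.rep_eq ordIso_reflexive ordLess_ordIso_trans)
      moreover from this have "Well_order (rep_ordinal y)"
        by (simp add: ordLess_def)
      ultimately have "P (abs_ordinal (rep_ordinal y))"
        using 1(1) by blast
      then show "P y"
        by (simp add: Quotient_abs_rep[OF Quotient_ordinal])
    qed
  qed
  have "Well_order (rep_ordinal a)"
    using Quotient_rep_reflp[OF Quotient_ordinal, of a] by (simp add: ordIso_def)
  from P_abs[OF this] show "P a"
    by (simp add: Quotient_abs_rep[OF Quotient_ordinal])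
qed

datatype 'o rank = Rank 'o | Infinite_Rank

instantiation rank :: (wellorder) wellorder
begin

fun less_eq_rank :: "'a rank \<Rightarrow> 'a rank \<Rightarrow> bool" where
  "less_eq_rank _ Infinite_Rank = True"
| "less_eq_rank Infinite_Rank (Rank b) = False"
| "less_eq_rank (Rank a) (Rank b) = (a \<le> b)"

definition less_rank :: "'a rank \<Rightarrow> 'a rank \<Rightarrow> bool" where
  "less_rank x y \<longleftrightarrow> x \<le> y \<and> \<not> y \<le> x"

instance
proof
  fix x y z :: "'a rank"
  show "x < y \<longleftrightarrow> x \<le> y \<and> \<not> y \<le> x" by (rule less_rank_def)
  show "x \<le> x" by (cases x) auto
  show "x \<le> y \<Longrightarrow> y \<le> z \<Longrightarrow> x \<le> z" by (cases x; cases y; cases z) auto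
  show "x \<le> y \<Longrightarrow> y \<le> x \<Longrightarrow> x = y" by (cases x; cases y) auto
  show "x \<le> y \<or> y \<le> x" by (cases x; cases y) auto
next
  fix P :: "'a rank \<Rightarrow> bool" and a :: "'a rank"
  assume step: "\<And>x. (\<And>y. y < x \<Longrightarrow> P y) \<Longrightarrow> P x"
  have P_Rank: "P (Rank \<beta>)" for \<beta>
  proof (induction \<beta> rule: less_induct)
    case (less \<beta>)
    show ?case
    proof (rule step)
      fix y assume "y < Rank \<beta>"
      then show "P y" by (cases y) (auto simp: less_rank_def less)
    qed
  qed
  have "P Infinite_Rank"
  proof (rule step)
    fix y assume "y < (Infinite_Rank :: 'a rank)"
    then show "P y" by (cases y) (auto simp: less_rank_def P_Rank)
  qed
  with P_Rank show "P a" by (cases a) auto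
qed

end


section \<open>Category\<close>

definition nowhere_dense_in :: "'a topology \<Rightarrow> 'a set \<Rightarrow> bool" where
  "nowhere_dense_in T S \<longleftrightarrow> S \<subseteq> topspace T \<and> T interior_of (T closure_of S) = {}"

definition meager_in :: "'a topology \<Rightarrow> 'a set \<Rightarrow> bool" where
  "meager_in T S \<longleftrightarrow> (\<exists>\<F>. countable \<F> \<and> (\<forall>N\<in>\<F>. nowhere_dense_in T N) \<and> S = \<Union>\<F>)"


section \<open>Polish structures and compact G-groups\<close>

locale topological_group_on = group G for G (structure) +
  fixes T
  assumes topspace_eq: "topspace T = carrier G"
    and continuous_mult: "continuous_map (prod_topology T T) T (\<lambda>(x, y). x \<otimes> y)"
    and continuous_inv: "continuous_map T T (\<lambda>x. inv x)"

locale polish_group = topological_group_on +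
  assumes completely_metrizable: "completely_metrizable_space T"
    and separable: "separable_space T"

locale polish_structure = polish_group G T + faithful_action G X \<phi>
  for G (structure) and T and X and \<phi> +
  assumes closed_stabilizer: "x \<in> X \<Longrightarrow> closedin T (stabilizer G \<phi> x)"

locale compact_G_group =
  H: topological_group_on H TH + polish_structure G TG "carrier H" \<phi>
  for H (structure) and TH and G and TG and \<phi> +
  assumes compact: "compact_space TH"
    and Hausdorff: "Hausdorff_space TH"
    and automorphism: "g \<in> carrier G \<Longrightarrow> \<phi> g \<in> auto H"
    and continuous_action: "continuous_map (prod_topology TG TH) TH (\<lambda>(g, x). \<phi> g x)"

text \<open>Finite tuples are lists, on which the group acts by \<open>\<lambda>g. map (\<phi> g)\<close>.\<close>

definition small :: "('g, 'm) monoid_scheme \<Rightarrow> 'x set \<Rightarrow> ('g \<Rightarrow> 'x \<Rightarrow> 'x) \<Rightarrow> bool" where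
  "small G X \<phi> \<longleftrightarrow>
     (\<forall>n. countable (orbits G {xs. set xs \<subseteq> X \<and> length xs = n} (\<lambda>g. map (\<phi> g))))"

definition empty_closed ::
    "'x topology \<Rightarrow> ('g, 'm) monoid_scheme \<Rightarrow> ('g \<Rightarrow> 'x \<Rightarrow> 'x) \<Rightarrow> 'x set \<Rightarrow> bool" where
  "empty_closed TX G \<phi> D \<longleftrightarrow> closedin TX D \<and> (\<forall>g \<in> carrier G. \<phi> g ` D = D)"


section \<open>nm-independence and NM-rank\<close>

definition pointwise_stabilizer ::
    "('g, 'm) monoid_scheme \<Rightarrow> ('g \<Rightarrow> 'x \<Rightarrow> 'x) \<Rightarrow> 'x set \<Rightarrow> 'g set" where
  "pointwise_stabilizer G \<phi> A = {g \<in> carrier G. \<forall>x\<in>A. \<phi> g x = x}"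

definition orbit_over ::
    "('g, 'm) monoid_scheme \<Rightarrow> ('g \<Rightarrow> 'x \<Rightarrow> 'x) \<Rightarrow> 'x list \<Rightarrow> 'x set \<Rightarrow> 'x list set" where
  "orbit_over G \<phi> a A = (\<lambda>g. map (\<phi> g) a) ` pointwise_stabilizer G \<phi> A"

definition orbit_preimage ::
    "('g, 'm) monoid_scheme \<Rightarrow> ('g \<Rightarrow> 'x \<Rightarrow> 'x) \<Rightarrow> 'x list \<Rightarrow> 'x set \<Rightarrow> 'x list set \<Rightarrow> 'g set" where
  "orbit_preimage G \<phi> a A C = {g \<in> pointwise_stabilizer G \<phi> A. map (\<phi> g) a \<in> C}"

definition nm_independent ::
    "('g, 'm) monoid_scheme \<Rightarrow> 'g topology \<Rightarrow> ('g \<Rightarrow> 'x \<Rightarrow> 'x) \<Rightarrow>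
     'x list \<Rightarrow> 'x set \<Rightarrow> 'x set \<Rightarrow> bool" where
  \<comment> \<open>\<open>a\<close> is independent from \<open>B\<close> over \<open>A\<close>\<close>
  "nm_independent G T \<phi> a B A \<longleftrightarrow>
     \<not> meager_in (subtopology T (orbit_preimage G \<phi> a A (orbit_over G \<phi> a A)))
         (orbit_preimage G \<phi> a A (orbit_over G \<phi> a (A \<union> B)))"

text \<open>
  \<open>nm_rank_ge G T X \<phi> \<alpha> a A\<close> says that the rank of \<open>a\<close> over \<open>A\<close> is at least \<open>\<alpha>\<close>. The single rule
  covers zero, successor and limit ordinals; see \<open>le_nm_rank_succ_iff\<close> and
  \<open>le_nm_rank_limit_iff\<close> below.
\<close>

inductive nm_rank_ge ::
    "('g, 'm) monoid_scheme \<Rightarrow> 'g topology \<Rightarrow> 'x set \<Rightarrow> ('g \<Rightarrow> 'x \<Rightarrow> 'x) \<Rightarrow>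
     'x ordinal \<Rightarrow> 'x list \<Rightarrow> 'x set \<Rightarrow> bool"
  for G T X \<phi> where
  "(\<And>\<beta>. \<beta> < \<alpha> \<Longrightarrow> \<exists>B. finite B \<and> A \<subseteq> B \<and> B \<subseteq> X \<and> \<not> nm_independent G T \<phi> a B A \<and>
       nm_rank_ge G T X \<phi> \<beta> a B) \<Longrightarrow>
   nm_rank_ge G T X \<phi> \<alpha> a A"

text \<open>
  Ordinals in \<^typ>\<open>'x ordinal\<close> suffice: the ordinal values of the rank form an initial segment,
  indexed by pairs of a finite tuple and a finite subset of \<open>X\<close>, so they all have cardinality at
  most that of \<^typ>\<open>'x\<close> when this type is infinite (when it is finite, all ranks are \<open>0\<close>).
\<close>

definition nm_rank ::
    "('g, 'm) monoid_scheme \<Rightarrow> 'g topology \<Rightarrow> 'x set \<Rightarrow> ('g \<Rightarrow> 'x \<Rightarrow> 'x) \<Rightarrow>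
     'x list \<Rightarrow> 'x set \<Rightarrow> 'x ordinal rank" where
  "nm_rank G T X \<phi> a A =
     (if \<forall>\<alpha>. nm_rank_ge G T X \<phi> \<alpha> a A then Infinite_Rank
      else Rank (GREATEST \<alpha>. nm_rank_ge G T X \<phi> \<alpha> a A))"

definition structure_nm_rank ::
    "('g, 'm) monoid_scheme \<Rightarrow> 'g topology \<Rightarrow> 'x set \<Rightarrow> ('g \<Rightarrow> 'x \<Rightarrow> 'x) \<Rightarrow> 'x ordinal rank" where
  \<comment> \<open>the supremum over all elements\<close>
  "structure_nm_rank G T X \<phi> = (LEAST \<rho>. \<forall>x\<in>X. nm_rank G T X \<phi> [x] {} \<le> \<rho>)"

definition nm_stable ::
    "('g, 'm) monoid_scheme \<Rightarrow> 'g topology \<Rightarrow> 'x set \<Rightarrow> ('g \<Rightarrow> 'x \<Rightarrow> 'x) \<Rightarrow> bool" where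
  "nm_stable G T X \<phi> \<longleftrightarrow> structure_nm_rank G T X \<phi> < Infinite_Rank"

lemma nm_rank_ge_iff:
  "nm_rank_ge G T X \<phi> \<alpha> a A \<longleftrightarrow>
     (\<forall>\<beta><\<alpha>. \<exists>B. finite B \<and> A \<subseteq> B \<and> B \<subseteq> X \<and> \<not> nm_independent G T \<phi> a B A \<and>
        nm_rank_ge G T X \<phi> \<beta> a B)"
  by (subst nm_rank_ge.simps) blast

lemma nm_rank_ge_antimono:
  "nm_rank_ge G T X \<phi> \<alpha> a A \<Longrightarrow> \<beta> \<le> \<alpha> \<Longrightarrow> nm_rank_ge G T X \<phi> \<beta> a A"
  by (subst nm_rank_ge_iff, subst (asm) nm_rank_ge_iff) (meson order.strict_trans2)

lemma nm_rank_ge_limit: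
  assumes "\<And>\<beta>. \<beta> < \<alpha> \<Longrightarrow> \<exists>\<gamma>. \<beta> < \<gamma> \<and> \<gamma> < \<alpha>"
  shows "nm_rank_ge G T X \<phi> \<alpha> a A \<longleftrightarrow> (\<forall>\<beta><\<alpha>. nm_rank_ge G T X \<phi> \<beta> a A)"
proof
  assume "\<forall>\<beta><\<alpha>. nm_rank_ge G T X \<phi> \<beta> a A"
  then show "nm_rank_ge G T X \<phi> \<alpha> a A"
    using assms by (subst nm_rank_ge_iff) (metis nm_rank_ge_iff)
qed (blast intro: nm_rank_ge_antimono less_imp_le)

lemma le_nm_rank_iff: "Rank \<alpha> \<le> nm_rank G T X \<phi> a A \<longleftrightarrow> nm_rank_ge G T X \<phi> \<alpha> a A"
proof (cases "\<forall>\<alpha>. nm_rank_ge G T X \<phi> \<alpha> a A")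
  case True
  then show ?thesis by (simp add: nm_rank_def)
next
  case False
  let ?P = "\<lambda>\<alpha>. nm_rank_ge G T X \<phi> \<alpha> a A"
  define \<delta> where "\<delta> = (LEAST \<alpha>. \<not> ?P \<alpha>)"
  have not: "\<not> ?P \<delta>" unfolding \<delta>_def using False by (intro LeastI_ex[of "\<lambda>\<alpha>. \<not> ?P \<alpha>"]) blast
  have below: "?P \<beta>" if "\<beta> < \<delta>" for \<beta>
    using that not_less_Least unfolding \<delta>_def by blast
  obtain \<mu> where \<mu>: "\<mu> < \<delta>" "\<And>\<gamma>. \<mu> < \<gamma> \<Longrightarrow> \<not> \<gamma> < \<delta>"
    using nm_rank_ge_limit[of \<delta> G T X \<phi> a A] not below by blast
  have upper: "\<gamma> \<le> \<mu>" if "?P \<gamma>" for \<gamma>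
  proof (rule ccontr)
    assume "\<not> \<gamma> \<le> \<mu>"
    then have "\<delta> \<le> \<gamma>" using \<mu>(2) by (meson not_le)
    with that not show False using nm_rank_ge_antimono by blast
  qed
  have "(GREATEST \<alpha>. ?P \<alpha>) = \<mu>"
    by (rule Greatest_equality) (auto intro: below \<mu> upper)
  then show ?thesis
    using False upper below[OF \<mu>(1)] by (auto simp: nm_rank_def intro: nm_rank_ge_antimono)
qed

lemma le_nm_rank_succ_iff:
  assumes "\<alpha> < \<beta>" and "\<And>\<gamma>. \<gamma> < \<beta> \<Longrightarrow> \<gamma> \<le> \<alpha>"
  shows "Rank \<beta> \<le> nm_rank G T X \<phi> a A \<longleftrightarrow>
    (\<exists>B. finite B \<and> A \<subseteq> B \<and> B \<subseteq> X \<and> \<not> nm_independent G T \<phi> a B A \<and>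
       Rank \<alpha> \<le> nm_rank G T X \<phi> a B)"
  unfolding le_nm_rank_iff
  by (subst nm_rank_ge_iff) (metis assms nm_rank_ge_antimono)

lemma le_nm_rank_limit_iff:
  assumes "\<And>\<beta>. \<beta> < \<alpha> \<Longrightarrow> \<exists>\<gamma>. \<beta> < \<gamma> \<and> \<gamma> < \<alpha>"
  shows "Rank \<alpha> \<le> nm_rank G T X \<phi> a A \<longleftrightarrow> (\<forall>\<beta><\<alpha>. Rank \<beta> \<le> nm_rank G T X \<phi> a A)"
  unfolding le_nm_rank_iff using nm_rank_ge_limit[OF assms] .

end

theory Submission
  imports Defs "HOL-Algebra.Elementary_Groups"
begin

text \<open>
  Let \<open>V\<close> be the vector space over the field with two elements with a countable basis, each basis
  vector carrying a level below \<open>\<alpha>\<close> and each level carrying infinitely many of them. \<open>H\<close> is the dual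
  of \<open>V\<close>, a compact group, and \<open>G\<close> is the group of all automorphisms of \<open>V\<close> that preserve the level
  \<open>v x\<close> of a vector (the least level occurring in it), a closed subgroup of the symmetric group of a
  countable set. Put \<open>K i = {f \<in> H. f vanishes on vectors of level at least i}\<close> and let \<open>r f\<close> be
  the least \<open>i\<close> with \<open>f \<in> K i\<close>.

  A back-and-forth argument shows that the orbit of a finite tuple in \<open>H\<close> is determined by the values
  of \<open>r\<close> on its finitely many linear combinations, whence smallness. For finite \<open>A\<close> let \<open>rk h A\<close> be
  the least value of \<open>r\<close> on \<open>h + span A\<close>. If \<open>\<gamma> < rk h A\<close>, the \<open>g\<close> in the stabilizer of \<open>A\<close> that
  move \<open>h\<close> into a fixed coset of \<open>K \<gamma>\<close> form a nowhere dense set, because \<open>h\<close> can be pushed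
  off the coset by a transvection that fixes \<open>A\<close> and any prescribed finite set of vectors. By the
  Baire category theorem \<open>h\<close> is independent from \<open>B\<close> over \<open>A\<close> iff \<open>rk h B = rk h A\<close>, and since all
  smaller values of \<open>rk\<close> are attained over larger finite sets, \<open>rk\<close> is the \<open>NM\<close>-rank.

  For \<open>\<alpha> = 0\<close> there are no levels and the trivial group is used.
\<close>

unbundle bit_operations_syntax

section \<open>The topology of pointwise convergence on sequences of naturals\<close>

text \<open>The factors are discrete, so a basic open box constrains finitely many coordinates and
  can be shrunk to single values there.\<close>

lemma open_seq_iff:
  fixes U :: "(nat \<Rightarrow> nat) set"
  shows "open U \<longleftrightarrow> (\<forall>f\<in>U. \<exists>S. finite S \<and> (\<forall>g. (\<forall>s\<in>S. g s = f s) \<longrightarrow> g \<in> U))"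
proof (intro iffI ballI)
  fix f assume "open U" "f \<in> U"
  then obtain X where X: "f \<in> (\<Pi>\<^sub>E i\<in>UNIV. X i)" "finite {i. X i \<noteq> UNIV}" "(\<Pi>\<^sub>E i\<in>UNIV. X i) \<subseteq> U"
    using product_topology_open_contains_basis[of "\<lambda>_. euclidean" UNIV U f]
    unfolding open_fun_def by (auto simp only: topspace_euclidean)
  have "g \<in> U" if "\<forall>s\<in>{i. X i \<noteq> UNIV}. g s = f s" for g
  proof (rule subsetD[OF X(3)])
    have "g i \<in> X i" for i
      using X(1) that by (cases "X i = UNIV") (auto simp: PiE_UNIV_domain)
    then show "g \<in> (\<Pi>\<^sub>E i\<in>UNIV. X i)" by (simp add: PiE_UNIV_domain)
  qed
  with X(2) show "\<exists>S. finite S \<and> (\<forall>g. (\<forall>s\<in>S. g s = f s) \<longrightarrow> g \<in> U)" by blast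
next
  assume loc: "\<forall>f\<in>U. \<exists>S. finite S \<and> (\<forall>g. (\<forall>s\<in>S. g s = f s) \<longrightarrow> g \<in> U)"
  show "open U"
  proof (subst open_subopen, intro ballI)
    fix f assume "f \<in> U"
    with loc obtain S where S: "finite S" "\<And>g. (\<forall>s\<in>S. g s = f s) \<Longrightarrow> g \<in> U" by blast
    have "open {g. \<forall>i\<in>S. g i \<in> {f i}}"
      by (rule product_topology_basis'[of S "\<lambda>i. {f i}" "\<lambda>i. i"]) (use S in \<open>auto simp: open_discrete\<close>)
    then show "\<exists>T. open T \<and> f \<in> T \<and> T \<subseteq> U" using S(2) by (intro exI conjI) auto
  qed
qed

text \<open>Both \<open>P\<close> and its negation are decided by the values on \<open>S\<close>.
  Closed sets given by infinitely many conditions are later obtained as intersections of such clopen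
  sets.\<close>

lemma open_seq_local:
  assumes "finite S" "\<And>f g :: nat \<Rightarrow> nat. (\<forall>s\<in>S. g s = f s) \<Longrightarrow> P g = P f"
  shows "open {f. P f}" "closed {f. P f}"
proof -
  show "open {f. P f}" unfolding open_seq_iff using assms by blast
  have "open {f. \<not> P f}" unfolding open_seq_iff using assms by blast
  then show "closed {f. P f}" by (simp add: closed_def Compl_eq)
qed

lemma continuous_on_locally_constant:
  assumes "\<And>p. p \<in> S \<Longrightarrow> \<exists>U. open U \<and> p \<in> U \<and> (\<forall>q\<in>U \<inter> S. f q = f p)"
  shows "continuous_on S f"
  unfolding continuous_on_topological using assms by (metis IntI)

text \<open>In the completely metrizable space of sequences, closed sets and countable intersections
  of open sets are G-delta, and G-delta subspaces inherit complete metrizability.\<close>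

lemma completely_metrizable_top_of_set:
  fixes S :: "(nat \<Rightarrow> nat) set"
  assumes "closed C" "countable \<U>" "\<And>U. U \<in> \<U> \<Longrightarrow> open U" "S = C \<inter> \<Inter>\<U>"
  shows "completely_metrizable_space (top_of_set S)"
proof -
  have "(euclidean :: nat topology) = discrete_topology UNIV"
    by (simp add: topology_eq open_discrete)
  then have eu: "completely_metrizable_space (euclidean :: (nat \<Rightarrow> nat) topology)"
    unfolding euclidean_product_topology[symmetric]
    by (simp add: completely_metrizable_space_product_topology completely_metrizable_space_discrete_topology)
  have "gdelta_in (euclidean :: (nat \<Rightarrow> nat) topology) C"
    using completely_metrizable_imp_metrizable_space[OF eu] closed_imp_gdelta_in assms(1)
    by (metis closed_closedin)
  moreover have "gdelta_in (euclidean :: (nat \<Rightarrow> nat) topology) (\<Inter>\<U>)"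
  proof (cases "\<U> = {}")
    case False
    then show ?thesis using assms by (intro gdelta_in_Inter) (auto intro: open_imp_gdelta_in)
  qed (metis Inter_empty gdelta_in_topspace topspace_euclidean)
  ultimately show ?thesis
    unfolding assms(4) by (intro completely_metrizable_space_gdelta_in eu gdelta_in_Int)
qed

text \<open>Otherwise the whole space would be a countable union of closed sets with empty interior,
  against the Baire category theorem.\<close>

lemma not_meager_if_comeager:
  assumes T: "completely_metrizable_space T" and ne: "topspace T \<noteq> {}"
    and "countable \<N>" and nd: "\<And>N. N \<in> \<N> \<Longrightarrow> nowhere_dense_in T N"
    and sub: "topspace T - \<Union>\<N> \<subseteq> S"
  shows "\<not> meager_in T S"
proof
  assume "meager_in T S"
  then obtain \<F> where F: "countable \<F>" "\<And>N. N \<in> \<F> \<Longrightarrow> nowhere_dense_in T N" "S = \<Union>\<F>"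
    unfolding meager_in_def by auto
  let ?C = "(\<lambda>N. T closure_of N) ` (\<N> \<union> \<F>)"
  have "T interior_of \<Union>?C = {}"
    using assms(1,3) F(1,2) nd
    by (intro Baire_category_alt) (auto simp: nowhere_dense_in_def)
  moreover have "\<Union>?C = topspace T"
  proof
    show "\<Union>?C \<subseteq> topspace T" by (auto simp: closure_of_def)
    have "N \<subseteq> T closure_of N" if "N \<in> \<N> \<union> \<F>" for N
      using that nd F(2) by (auto simp: nowhere_dense_in_def intro!: subsetD[OF closure_of_subset])
    then show "topspace T \<subseteq> \<Union>?C" using sub F(3) by blast
  qed
  ultimately show False using ne by (simp add: interior_of_topspace)
qed

text \<open>Continuity into a product is tested coordinatewise, and here each coordinate is locally
  constant. This serves both group multiplications and the action.\<close>

lemma continuous_map_pair_local: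
  fixes f :: "(nat \<Rightarrow> nat) \<times> (nat \<Rightarrow> nat) \<Rightarrow> nat \<Rightarrow> nat"
  assumes into: "\<And>p. p \<in> A \<times> B \<Longrightarrow> f p \<in> C"
    and loc: "\<And>g h i. g \<in> A \<Longrightarrow> h \<in> B \<Longrightarrow> \<exists>S T. finite S \<and> finite T \<and>
      (\<forall>g'\<in>A. \<forall>h'\<in>B. (\<forall>s\<in>S. g' s = g s) \<longrightarrow> (\<forall>t\<in>T. h' t = h t) \<longrightarrow> f (g', h') i = f (g, h) i)"
  shows "continuous_map (prod_topology (top_of_set A) (top_of_set B)) (top_of_set C) f"
proof -
  have "continuous_on (A \<times> B) (\<lambda>p. f p i)" for i
  proof (rule continuous_on_locally_constant)
    fix p assume "p \<in> A \<times> B"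
    then obtain g h where p: "p = (g, h)" "g \<in> A" "h \<in> B" by auto
    from loc[OF p(2,3), of i] obtain S T where ST: "finite S" "finite T" and
      eq: "\<forall>g'\<in>A. \<forall>h'\<in>B. (\<forall>s\<in>S. g' s = g s) \<longrightarrow> (\<forall>t\<in>T. h' t = h t) \<longrightarrow> f (g', h') i = f (g, h) i"
      by (elim exE conjE) (rule that)
    let ?U = "{g'. \<forall>s\<in>S. g' s = g s} \<times> {h'. \<forall>t\<in>T. h' t = h t}"
    have "open {g'. \<forall>s\<in>S. g' s = g s}" by (rule open_seq_local(1)[OF ST(1)]) auto
    moreover have "open {h'. \<forall>t\<in>T. h' t = h t}" by (rule open_seq_local(1)[OF ST(2)]) auto
    ultimately have "open ?U" by (rule open_Times)
    moreover have "p \<in> ?U" using p(1) by simp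
    moreover have "\<forall>q\<in>?U \<inter> A \<times> B. f q i = f p i"
      using eq unfolding p(1) by auto
    ultimately show "\<exists>U. open U \<and> p \<in> U \<and> (\<forall>q\<in>U \<inter> A \<times> B. f q i = f p i)"
      by (intro exI[of _ ?U] conjI)
  qed
  then have cont: "continuous_on (A \<times> B) f" by (rule continuous_on_coordinatewise_then_product)
  have eq: "prod_topology (top_of_set A) (top_of_set B) = top_of_set (A \<times> B)"
    by (simp only: subtopology_Times[symmetric] prod_topology_euclidean)
  show ?thesis
    unfolding eq continuous_map_subtopology_eu by (intro conjI cont Pi_I into)
qed

lemma separable_top_of_set:
  "separable_space (top_of_set (S :: 'a::second_countable_topology set))"
proof -
  obtain B :: "'a set set" where B: "countable B" "topological_basis B"
    using ex_countable_basis by blast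
  have "second_countable (euclidean :: 'a topology)"
    unfolding second_countable_def
  proof (intro exI[of _ B] conjI ballI allI impI)
    show "openin euclidean V" if "V \<in> B" for V using that B(2) by (auto intro: topological_basis_open)
    show "\<exists>V\<in>B. x \<in> V \<and> V \<subseteq> U" if "openin euclidean U \<and> x \<in> U" for U x
      using that B(2) by (metis open_openin topological_basisE)
  qed (rule B(1))
  then show ?thesis
    by (intro second_countable_imp_separable_space second_countable_subtopology)
qed

section \<open>Countability and ordinals\<close>

text \<open>On \<open>E\<close> the map \<open>f\<close> factors through \<open>t\<close>. For
  smallness, \<open>t\<close> will be an invariant of tuples and \<open>f\<close> the orbit
  map.\<close>

lemma countable_image_factor:
  assumes "countable (t ` E)" "\<And>x y. x \<in> E \<Longrightarrow> y \<in> E \<Longrightarrow> t x = t y \<Longrightarrow> f x = f y"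
  shows "countable (f ` E)"
proof -
  have "f x = f (inv_into E t (t x))" if "x \<in> E" for x
    using that assms(2) by (metis f_inv_into_f imageI inv_into_into)
  then have "f ` E = (\<lambda>z. f (inv_into E t z)) ` t ` E" by (auto simp: image_image)
  with assms(1) show ?thesis by simp
qed

lemma uncountable_sequences: "uncountable (UNIV :: (nat \<Rightarrow> nat) set)"
proof
  assume "countable (UNIV :: (nat \<Rightarrow> nat) set)"
  then obtain s :: "nat \<Rightarrow> nat \<Rightarrow> nat" where "range s = UNIV"
    by (metis UNIV_not_empty uncountable_def)
  then obtain n where "s n = (\<lambda>k. Suc (s k k))" by (metis UNIV_I imageE)
  then have "s n n = Suc (s n n)" by (rule fun_cong)
  then show False by simp
qed

text \<open>This rules out the junk case that \<^const>\<open>Infinite_Rank\<close> arises because the type of ordinals is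
  exhausted.\<close>

lemma ex_greater_ordinal:
  fixes \<alpha> :: "'a ordinal"
  assumes "countable {..<\<alpha>}" "uncountable (UNIV :: 'a set)"
  shows "\<exists>\<beta>. \<alpha> < \<beta>"
proof -
  let ?r = "rep_ordinal \<alpha>" and ?u = "card_of (UNIV :: 'a set)"
  have W: "Well_order ?r"
    using Quotient_rep_reflp[OF Quotient_ordinal, of \<alpha>] by (simp add: ordIso_def)
  have abs: "abs_ordinal ?r = \<alpha>" by (simp add: Quotient_abs_rep[OF Quotient_ordinal])
  have less_iff: "abs_ordinal s < abs_ordinal t \<longleftrightarrow> (s, t) \<in> ordLess"
    if "Well_order s" "Well_order t" for s t :: "'a rel"
    using that by (simp add: less_ordinal.abs_eq ordIso_reflexive)
  \<comment> \<open>The ordinal sought is the cardinal of the whole type. If it did not exceed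
    \<open>?r\<close>, the field of \<open>?r\<close> would be uncountable.\<close>
  have "(?r, ?u) \<in> ordLess"
  proof (rule ccontr)
    assume "(?r, ?u) \<notin> ordLess"
    then have "(?u, ?r) \<in> ordLeq" using ordLess_or_ordLeq[OF W card_of_Well_order] by blast
    then have "(?u, card_of (Field ?r)) \<in> ordLeq"
      using card_of_mono2 by (metis Field_card_of)
    then obtain f :: "'a \<Rightarrow> 'a" where "inj f" "range f \<subseteq> Field ?r"
      using card_of_ordLeq by metis
    then have unc: "uncountable (Field ?r)"
      using assms(2) countable_image_inj_on countable_subset by metis
    \<comment> \<open>Sending a point to the type of its initial segment injects the field into the
      ordinals below \<open>\<alpha>\<close>, of which there are only countably many.\<close>
    let ?J = "\<lambda>a. abs_ordinal (Restr ?r (underS ?r a))"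
    have less: "?J a < ?J b" if "a \<in> underS ?r b" for a b
    proof -
      have wo: "wo_rel ?r" using W by (simp add: wo_rel_def)
      have "underS ?r a \<subseteq> underS ?r b" "a \<notin> underS ?r a"
        using that W by (auto simp: underS_def order_on_defs dest: transD antisymD)
      then have "underS ?r a \<subset> underS ?r b" using that by blast
      then show ?thesis
        using W Well_order_Restr[OF W] ofilter_subset_ordLess[OF W] wo_rel.underS_ofilter[OF wo]
        by (simp add: less_iff)
    qed
    have "inj_on ?J (Field ?r)"
    proof (rule inj_onI, rule ccontr)
      fix a b assume ab: "a \<in> Field ?r" "b \<in> Field ?r" "?J a = ?J b" "a \<noteq> b"
      then have "a \<in> underS ?r b \<or> b \<in> underS ?r a"
        using W by (auto simp: underS_def order_on_defs total_on_def)
      with less ab(3) show False by (metis less_irrefl)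
    qed
    moreover have "?J ` Field ?r \<subseteq> {..<\<alpha>}"
    proof (rule image_subsetI)
      fix a assume "a \<in> Field ?r"
      then have "(Restr ?r (underS ?r a), ?r) \<in> ordLess"
        using underS_Restr_ordLess[OF W] by blast
      then have "?J a < abs_ordinal ?r" using W Well_order_Restr[OF W] by (simp add: less_iff)
      then show "?J a \<in> {..<\<alpha>}" using abs by simp
    qed
    ultimately show False
      using unc assms(1) countable_subset countable_image_inj_on by blast
  qed
  then have "abs_ordinal ?r < abs_ordinal ?u" by (simp only: less_iff[OF W card_of_Well_order])
  then show ?thesis using abs by auto
qed

section \<open>Bit vectors\<close>

text \<open>A natural number stands for a finite set of naturals. Under \<open>XOR\<close> the
  naturals thus form a vector space over the field with two elements, with the powers of 2 as
  basis.\<close>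

abbreviation bits :: "nat \<Rightarrow> nat set" where "bits x \<equiv> {m. bit x m}"

lemma finite_bits [simp]: "finite (bits x)"
proof (rule finite_subset)
  show "bits x \<subseteq> {..<x}"
  proof (clarsimp, rule ccontr)
    fix m assume "bit x m" "\<not> m < x"
    then have "x < 2 ^ m" using less_exp[of m] by linarith
    with \<open>bit x m\<close> show False by (simp add: bit_iff_odd)
  qed
qed simp

lemma bits_XOR: "bits (x XOR y) = (bits x - bits y) \<union> (bits y - bits x)" for x y :: nat
  by (auto simp: bit_xor_iff)

lemma bits_eq_empty_iff: "bits x = {} \<longleftrightarrow> x = 0" for x :: nat
  by (auto simp: bit_eq_iff)

lemma XOR_cancel [simp]: "x XOR (x XOR y) = y" for x y :: nat
  by (simp flip: xor.assoc)

lemma XOR_eq_0_iff: "x XOR y = 0 \<longleftrightarrow> x = y" for x y :: nat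
  by (metis XOR_cancel xor.right_neutral xor_self_eq)

section \<open>Linear functionals and their sums\<close>

definition functionals :: "(nat \<Rightarrow> nat) set" where
  "functionals = {f. \<forall>x y. f (x XOR y) = (f x + f y) mod 2}"

definition fadd :: "(nat \<Rightarrow> nat) \<Rightarrow> (nat \<Rightarrow> nat) \<Rightarrow> nat \<Rightarrow> nat" where
  "fadd f g = (\<lambda>x. (f x + g x) mod 2)"

text \<open>Summing over indices rather than over a set of functionals counts repeated members of a
  tuple with multiplicity. Sets of functionals are indexed by \<open>id\<close>.\<close>

definition comb :: "('k \<Rightarrow> nat \<Rightarrow> nat) \<Rightarrow> 'k set \<Rightarrow> nat \<Rightarrow> nat" where
  "comb F c = (\<lambda>x. (\<Sum>k\<in>c. F k x) mod 2)"

lemma functionalD: "f \<in> functionals \<Longrightarrow> f (x XOR y) = (f x + f y) mod 2"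
  by (simp only: functionals_def mem_Collect_eq)

text \<open>Since \<open>x XOR 0 = x\<close>, the defining equation exhibits every value as a
  remainder modulo 2.\<close>

lemma functional_mod: "f \<in> functionals \<Longrightarrow> f x mod 2 = f x"
  using functionalD[of f x 0] functionalD[of f 0 0] by (metis mod_mod_trivial xor.right_neutral)

lemma functional_cases: "f \<in> functionals \<Longrightarrow> f x = 0 \<or> f x = 1"
  using functional_mod[of f x] by presburger

lemma functional_0: "f \<in> functionals \<Longrightarrow> f 0 = 0"
  using functionalD[of f 0 0] by (simp flip: mult_2)

lemma functional_zero: "(\<lambda>_. 0) \<in> functionals"
  by (simp add: functionals_def)

lemma comb_functional: "(\<And>k. k \<in> c \<Longrightarrow> F k \<in> functionals) \<Longrightarrow> comb F c \<in> functionals"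
proof -
  assume F: "\<And>k. k \<in> c \<Longrightarrow> F k \<in> functionals"
  have "(\<Sum>k\<in>c. F k (x XOR y)) mod 2 = (\<Sum>k\<in>c. F k x + F k y) mod 2" for x y
    using F by (subst mod_sum_eq[symmetric]) (simp add: functionalD mod_sum_eq cong: sum.cong)
  then show ?thesis by (simp add: functionals_def comb_def sum.distrib mod_add_eq)
qed

lemma fadd_functional: "f \<in> functionals \<Longrightarrow> g \<in> functionals \<Longrightarrow> fadd f g \<in> functionals"
proof -
  assume f: "f \<in> functionals" and g: "g \<in> functionals"
  have "(f (x XOR y) + g (x XOR y)) mod 2 = ((f x + g x) mod 2 + (f y + g y) mod 2) mod 2" for x y
    by (simp only: functionalD[OF f] functionalD[OF g] mod_add_eq add_ac)
  then show ?thesis unfolding functionals_def fadd_def by blast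
qed

lemma fadd_assoc: "fadd (fadd f g) h = fadd f (fadd g h)"
  by (simp add: fadd_def mod_simps add_ac)

lemma fadd_commute: "fadd f g = fadd g f"
  by (simp add: fadd_def add.commute)

lemma fadd_zero: "f \<in> functionals \<Longrightarrow> fadd (\<lambda>_. 0) f = f"
  by (simp add: fadd_def functional_mod)

lemma fadd_self: "fadd f f = (\<lambda>_. 0)"
  by (simp add: fadd_def flip: mult_2)

lemma fadd_cancel: "f \<in> functionals \<Longrightarrow> fadd (fadd f g) g = f"
  by (simp only: fadd_assoc fadd_self) (simp only: fadd_commute[of f] fadd_zero)

lemma mod2_sum_cancel: "((p + r) mod 2 + (q + r) mod 2) mod 2 = (p + q) mod (2::nat)"
proof -
  have "(p + r + (q + r)) mod 2 = (p + q + 2 * r) mod 2" by (simp add: mult_2 add_ac)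
  then show ?thesis by (simp only: mod_add_eq mod_mult_self2)
qed

lemma mod2_cancel: "(a + c) mod 2 = (b + c) mod (2::nat) \<Longrightarrow> a mod 2 = b mod 2"
  by presburger

lemma comb_insert:
  assumes "finite c" "k \<notin> c"
  shows "comb F (insert k c) = fadd (F k) (comb F c)"
  using assms by (simp add: comb_def fadd_def mod_simps)

text \<open>The functional with value 1 on the basis vectors \<open>2 ^ m\<close> for
  \<open>m \<in> P\<close> and 0 on the others. \<open>P\<close> may be infinite, because
  \<open>bits x\<close> is finite.\<close>

definition parity :: "nat set \<Rightarrow> nat \<Rightarrow> nat" where
  "parity P x = card (bits x \<inter> P) mod 2"

lemma parity_functional: "parity P \<in> functionals"
proof -
  have "parity P (x XOR y) = (parity P x + parity P y) mod 2" for x y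
  proof -
    let ?X = "bits x \<inter> P" and ?Y = "bits y \<inter> P"
    have "card ?X = card (?X - ?Y) + card (?X \<inter> ?Y)" "card ?Y = card (?Y - ?X) + card (?X \<inter> ?Y)"
      using card_Int_Diff[of ?X ?Y] card_Int_Diff[of ?Y ?X] by (simp_all add: Int_commute)
    moreover have "card (bits (x XOR y) \<inter> P) = card (?X - ?Y) + card (?Y - ?X)"
    proof -
      have "bits (x XOR y) \<inter> P = (?X - ?Y) \<union> (?Y - ?X)" by (auto simp: bits_XOR)
      moreover have "card ((?X - ?Y) \<union> (?Y - ?X)) = card (?X - ?Y) + card (?Y - ?X)"
        by (intro card_Un_disjoint) auto
      ultimately show ?thesis by simp
    qed
    ultimately show ?thesis unfolding parity_def by (simp only: mod2_sum_cancel)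
  qed
  then show ?thesis by (simp add: functionals_def)
qed

lemma bits_exp [simp]: "bits (2 ^ m) = {m}"
  by (auto simp: bit_exp_iff)

lemma parity_exp: "parity P (2 ^ m) = (if m \<in> P then 1 else 0)"
  by (simp add: parity_def)

lemma parity_singleton: "parity {m} x = (if bit x m then 1 else 0)"
  by (simp add: parity_def)

text \<open>Gaussian elimination on the subspace \<open>M\<close>: a functional vanishing on
  \<open>M\<close> gives a trivial equation, any other serves as a pivot, and relations among the
  reduced equations lift to relations among the original ones.\<close>

lemma linear_system_solvable:
  assumes "finite K" "\<And>k. k \<in> K \<Longrightarrow> F k \<in> functionals"
    and M: "0 \<in> M" "\<And>x y. x \<in> M \<Longrightarrow> y \<in> M \<Longrightarrow> x XOR y \<in> M"
    and "\<And>c. c \<subseteq> K \<Longrightarrow> (\<And>x. x \<in> M \<Longrightarrow> comb F c x = 0) \<Longrightarrow> (\<Sum>k\<in>c. t k) mod 2 = (0::nat)"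
  shows "\<exists>y\<in>M. \<forall>k\<in>K. F k y = t k mod 2"
  using assms(1,2,5)
proof (induction K arbitrary: F t rule: finite_induct)
  case empty
  then show ?case using M(1) by blast
next
  case (insert n K)
  show ?case
  proof (cases "\<forall>x\<in>M. F n x = 0")
    case True
    have "\<exists>y\<in>M. \<forall>k\<in>K. F k y = t k mod 2"
      using insert.prems by (intro insert.IH) auto
    moreover have "t n mod 2 = 0"
      using insert.prems(2)[of "{n}"] True by (simp add: comb_def)
    ultimately show ?thesis using True by auto
  next
    case False
    have Fn: "F n \<in> functionals" using insert.prems by simp
    with False obtain m where m: "m \<in> M" "F n m = 1" using functional_cases by blast
    \<comment> \<open>Eliminate the unknown in direction \<open>m\<close>, on which the new functionals vanish.\<close>
    define F' where "F' k x = (F k x + F k m * F n x) mod 2" for k x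
    define t' where "t' k = t k + F k m * t n" for k
    have F'_add: "F' k \<in> functionals" if "k \<in> K" for k
    proof -
      have Fk: "F k \<in> functionals" using that insert.prems by simp
      from functional_cases[OF Fk, of m] show ?thesis
      proof
        assume "F k m = 0"
        then have "F' k = F k" by (simp add: F'_def functional_mod[OF Fk] fun_eq_iff)
        with Fk show ?thesis by simp
      next
        assume "F k m = 1"
        then have "F' k = fadd (F k) (F n)" by (simp add: F'_def fadd_def fun_eq_iff)
        with Fk Fn show ?thesis by (simp add: fadd_functional)
      qed
    qed
    have "\<exists>y\<in>M. \<forall>k\<in>K. F' k y = t' k mod 2"
    proof (rule insert.IH[OF F'_add])
      fix c assume c: "c \<subseteq> K" and van: "\<And>x. x \<in> M \<Longrightarrow> comb F' c x = 0"
      have fc: "finite c" "n \<notin> c" using c insert.hyps finite_subset by auto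
      have F'sum: "comb F' c x = ((\<Sum>k\<in>c. F k x) + (\<Sum>k\<in>c. F k m) * F n x) mod 2" for x
        unfolding comb_def F'_def by (simp add: mod_sum_eq sum.distrib sum_distrib_right)
      have van_even: "even ((\<Sum>k\<in>c. F k x) + (\<Sum>k\<in>c. F k m) * F n x)" if "x \<in> M" for x
        using van[OF that] F'sum[of x] by (simp only: mod_0_imp_dvd)
      \<comment> \<open>A relation among the reduced equations is one among the original equations,
        with the pivot equation included exactly when the total coefficient is odd.\<close>
      show "(\<Sum>k\<in>c. t' k) mod 2 = 0"
      proof (cases "even (\<Sum>k\<in>c. F k m)")
        case True
        have "(\<Sum>k\<in>c. t k) mod 2 = 0"
        proof (rule insert.prems(2))
          show "comb F c x = 0" if "x \<in> M" for x
            using True van_even[OF that] by (simp add: comb_def)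
        qed (use c in auto)
        with True show ?thesis
          unfolding t'_def sum.distrib sum_distrib_right[symmetric] by auto
      next
        case False
        have "(\<Sum>k\<in>insert n c. t k) mod 2 = 0"
        proof (rule insert.prems(2))
          show "comb F (insert n c) x = 0" if "x \<in> M" for x
            using False fc van_even[OF that] by (simp add: comb_def mod_eq_0_iff_dvd)
        qed (use c in auto)
        with False fc show ?thesis
          unfolding t'_def sum.distrib sum_distrib_right[symmetric]
          by (simp add: mod_eq_0_iff_dvd)
      qed
    qed
    then obtain y where y: "y \<in> M" "\<And>k. k \<in> K \<Longrightarrow> F' k y = t' k mod 2" by blast
    \<comment> \<open>The reduced functionals vanish at \<open>m\<close>, so adding \<open>m\<close>
      repairs the pivot equation and keeps the reduced ones.\<close>
    define z where "z = (if F n y = t n mod 2 then y else y XOR m)"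
    have zM: "z \<in> M" using y m M(2) by (simp add: z_def)
    have "t n mod 2 = 0 \<or> t n mod 2 = 1" by presburger
    then have Fnz: "F n z = t n mod 2"
      using functional_cases[OF Fn, of y] by (auto simp: z_def functionalD[OF Fn] m(2))
    have "F k z = t k mod 2" if "k \<in> K" for k
    proof -
      have Fk: "F k \<in> functionals" using that insert.prems by simp
      have "F' k (y XOR m) = F' k y"
        using functional_cases[OF Fk, of m] functional_cases[OF Fk, of y] functional_cases[OF Fn, of y]
        by (elim disjE) (simp_all add: F'_def functionalD[OF Fk] functionalD[OF Fn] m(2))
      then have "F' k z = F' k y" by (simp add: z_def)
      then have "(F k z + F k m * F n z) mod 2 = (t k + F k m * t n) mod 2"
        using y(2)[OF that] by (simp add: F'_def t'_def)
      then have "(F k z + F k m * t n) mod 2 = (t k + F k m * t n) mod 2"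
        unfolding Fnz by (metis mod_add_right_eq mod_mult_right_eq)
      then have "F k z mod 2 = t k mod 2" by (rule mod2_cancel)
      then show ?thesis using functional_mod[OF Fk] by simp
    qed
    with Fnz zM show ?thesis by auto
  qed
qed

section \<open>The group of functionals\<close>

definition functional_group :: "(nat \<Rightarrow> nat) monoid" where
  "functional_group = \<lparr>carrier = functionals, mult = fadd, one = (\<lambda>_. 0)\<rparr>"

lemma functional_group_simps [simp]:
  "carrier functional_group = functionals"
  "mult functional_group = fadd"
  "one functional_group = (\<lambda>_. 0)"
  by (simp_all add: functional_group_def)

lemma comm_group_functional_group: "comm_group functional_group"
proof (rule comm_groupI)
  fix f assume "f \<in> carrier functional_group"
  then show "\<exists>g\<in>carrier functional_group. g \<otimes>\<^bsub>functional_group\<^esub> f = \<one>\<^bsub>functional_group\<^esub>"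
    using fadd_self[of f] by auto
qed (auto simp: fadd_functional functional_zero fadd_assoc fadd_zero intro: fadd_commute)

lemma inv_functional_group: "f \<in> functionals \<Longrightarrow> m_inv functional_group f = f"
  using comm_group_functional_group
  by (intro group.inv_equality) (auto simp: comm_group_def fadd_self)

lemma comb_empty [simp]: "comb F {} = (\<lambda>_. 0)"
  by (simp add: comb_def)

text \<open>The index \<open>None\<close> adjoins \<open>h\<close> to a set of functionals as a
  separate member, even if \<open>h\<close> already belongs to the set.\<close>

lemma comb_option:
  assumes "finite c"
  shows "comb (case_option h id) c =
    (if None \<in> c then fadd h (comb id (Some -` c)) else comb id (Some -` c))"
proof -
  have Some: "comb (case_option h id) (Some ` d) = comb id d" for d
    by (simp add: comb_def sum.reindex)
  have c: "c = (if None \<in> c then insert None (Some ` (Some -` c)) else Some ` (Some -` c))"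
    by (auto simp: image_iff) (metis not_None_eq)+
  show ?thesis
  proof (cases "None \<in> c")
    case True
    then have "comb (case_option h id) c = comb (case_option h id) (insert None (Some ` (Some -` c)))"
      using c by simp
    also have "\<dots> = fadd h (comb id (Some -` c))"
      using assms by (subst comb_insert) (auto simp: Some simp del: image_vimage_eq intro!: finite_imageI finite_vimageI)
    finally show ?thesis using True by simp
  next
    case False
    then show ?thesis using c Some by metis
  qed
qed

lemma closed_functionals: "closed functionals"
  unfolding functionals_def
proof (intro closed_Collect_all)
  show "closed {f :: nat \<Rightarrow> nat. f (x XOR y) = (f x + f y) mod 2}" for x y
    by (rule open_seq_local(2)[of "{x, y, x XOR y}"]) auto
qed

text \<open>A closed subset of the compact product of two-point spaces.\<close>

lemma compact_functionals: "compact functionals"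
proof -
  have "compactin (product_topology (\<lambda>_. euclidean) UNIV) (\<Pi>\<^sub>E i\<in>UNIV. {0, 1} :: nat set)"
    unfolding compactin_PiE by (simp add: finite_imp_compact)
  then have "compact (\<Pi>\<^sub>E i\<in>(UNIV :: nat set). {0, 1} :: nat set)"
    by (simp add: euclidean_product_topology)
  then have "compact ((\<Pi>\<^sub>E i\<in>UNIV. {0, 1}) \<inter> functionals)"
    using closed_functionals by (rule compact_Int_closed)
  moreover have "functionals \<subseteq> (\<Pi>\<^sub>E i\<in>UNIV. {0, 1})"
  proof
    fix f assume "f \<in> functionals"
    then have "f i \<in> {0, 1}" for i using functional_cases by blast
    then show "f \<in> (\<Pi>\<^sub>E i\<in>UNIV. {0, 1})" by (simp add: PiE_UNIV_domain)
  qed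
  ultimately show ?thesis by (simp add: Int_absorb1)
qed

lemma topological_group_functionals:
  "topological_group_on functional_group (top_of_set functionals)"
proof (intro topological_group_on.intro topological_group_on_axioms.intro)
  show "Group.group functional_group"
    using comm_group_functional_group by (simp add: comm_group_def)
  have "continuous_map (prod_topology (top_of_set functionals) (top_of_set functionals))
    (top_of_set functionals) (\<lambda>(f, g). fadd f g)"
  proof (rule continuous_map_pair_local)
    fix f g :: "nat \<Rightarrow> nat" and i
    show "\<exists>S T. finite S \<and> finite T \<and> (\<forall>f'\<in>functionals. \<forall>g'\<in>functionals. (\<forall>s\<in>S. f' s = f s) \<longrightarrow>
      (\<forall>t\<in>T. g' t = g t) \<longrightarrow> (case (f', g') of (f, g) \<Rightarrow> fadd f g) i = (case (f, g) of (f, g) \<Rightarrow> fadd f g) i)"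
      by (intro exI[of _ "{i}"]) (auto simp: fadd_def)
  qed (auto intro: fadd_functional)
  then show "continuous_map (prod_topology (top_of_set functionals) (top_of_set functionals))
    (top_of_set functionals) (\<lambda>(f, g). f \<otimes>\<^bsub>functional_group\<^esub> g)" by simp
  have "continuous_map (top_of_set functionals) (top_of_set functionals) (\<lambda>f. f)" by simp
  then show "continuous_map (top_of_set functionals) (top_of_set functionals)
    (\<lambda>f. inv\<^bsub>functional_group\<^esub> f)"
    by (rule continuous_map_eq) (simp add: inv_functional_group)
qed simp

section \<open>A filtered vector space\<close>

text \<open>\<open>e\<close> may repeat values. Its range is nonempty, so the assumption makes
  \<open>\<alpha>\<close> nonzero as well as countable; hence the separate treatment of the trivial
  group.\<close>

locale flag =
  fixes e :: "nat \<Rightarrow> 'o::wellorder" and \<alpha> :: 'o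
  assumes range_e: "range e = {..<\<alpha>}"

context flag
begin

text \<open>The basis vectors \<open>2 ^ m\<close> are distributed over the levels below \<open>\<alpha>\<close>, infinitely many to each.\<close>

definition lev :: "nat \<Rightarrow> 'o" where
  "lev m = e (fst (prod_decode m))"

text \<open>The inserted \<open>\<alpha>\<close> is the value of the zero vector, which has no
  bits.\<close>

definition v :: "nat \<Rightarrow> 'o" where
  "v x = Min (insert \<alpha> (lev ` bits x))"

lemma lev_less: "lev m < \<alpha>"
  using range_e unfolding lev_def by blast

text \<open>The second component of the decoded pair numbers the basis vectors within a level, and
  any number may be prescribed.\<close>

lemma ex_lev:
  assumes "\<beta> < \<alpha>"
  obtains m where "lev m = \<beta>" "snd (prod_decode m) = n"
proof -
  from assms range_e obtain i where "e i = \<beta>" by (metis imageE lessThan_iff)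
  then show ?thesis using that[of "prod_encode (i, n)"] by (simp add: lev_def)
qed

lemma le_v_iff: "i \<le> v x \<longleftrightarrow> i \<le> \<alpha> \<and> (\<forall>m. bit x m \<longrightarrow> i \<le> lev m)"
  by (simp add: v_def)

lemma v_le: "v x \<le> \<alpha>"
  using le_v_iff by blast

lemma v_0 [simp]: "v 0 = \<alpha>"
  by (simp add: v_def)

lemma v_eq_top_iff: "v x = \<alpha> \<longleftrightarrow> x = 0"
proof
  assume "v x = \<alpha>"
  then have "bits x = {}" using le_v_iff[of \<alpha> x] lev_less by (metis empty_Collect_eq leD order_refl)
  then show "x = 0" using bits_eq_empty_iff by blast
qed simp

lemma v_less_top: "x \<noteq> 0 \<Longrightarrow> v x < \<alpha>"
  using v_le[of x] v_eq_top_iff[of x] by (auto simp: order_le_less)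

lemma le_v_XOR: "i \<le> v x \<Longrightarrow> i \<le> v y \<Longrightarrow> i \<le> v (x XOR y)"
  unfolding le_v_iff by (auto simp: bit_xor_iff)

lemma v_exp: "v (2 ^ m) = lev m"
  using less_imp_le[OF lev_less[of m]] by (simp add: v_def min_absorb2)

text \<open>The ultrametric equality: if the sum had larger value than \<open>x\<close>, then so
  would \<open>x\<close> itself, being the sum of \<open>x XOR y\<close> and
  \<open>y\<close>.\<close>

lemma v_XOR_less:
  assumes "v x < v y"
  shows "v (x XOR y) = v x"
proof (rule antisym)
  show "v x \<le> v (x XOR y)" using assms by (intro le_v_XOR) auto
  show "v (x XOR y) \<le> v x"
  proof (rule ccontr)
    assume "\<not> v (x XOR y) \<le> v x"
    then have less: "v x < min (v (x XOR y)) (v y)" using assms by auto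
    have "min (v (x XOR y)) (v y) \<le> v ((x XOR y) XOR y)" by (rule le_v_XOR) auto
    also have "(x XOR y) XOR y = x" by (simp add: xor.assoc)
    finally show False using less by (simp only: leD)
  qed
qed

section \<open>The dual value on functionals\<close>

definition r :: "(nat \<Rightarrow> nat) \<Rightarrow> 'o" where
  "r f = (LEAST i. \<forall>x. i \<le> v x \<longrightarrow> f x = 0)"

lemma r_le_iff:
  assumes "f \<in> functionals"
  shows "r f \<le> i \<longleftrightarrow> (\<forall>x. i \<le> v x \<longrightarrow> f x = 0)"
proof
  have "\<forall>x. \<alpha> \<le> v x \<longrightarrow> f x = 0"
    using v_le v_eq_top_iff functional_0[OF assms] by (metis antisym)
  then have "\<forall>x. r f \<le> v x \<longrightarrow> f x = 0" unfolding r_def by (rule LeastI)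
  then show "r f \<le> i \<Longrightarrow> \<forall>x. i \<le> v x \<longrightarrow> f x = 0" by auto
qed (simp add: r_def Least_le)

lemma r_le_top: "f \<in> functionals \<Longrightarrow> r f \<le> \<alpha>"
  using v_le v_eq_top_iff functional_0 r_le_iff by (metis antisym)

lemma r_fadd_le:
  assumes "f \<in> functionals" "g \<in> functionals" "r f \<le> i" "r g \<le> i"
  shows "r (fadd f g) \<le> i"
  using assms by (simp add: r_le_iff fadd_functional) (simp add: fadd_def)

text \<open>The ultrametric equality with maxima in place of minima: otherwise \<open>g\<close>, the
  sum of \<open>f\<close> and \<open>fadd f g\<close>, would have smaller value.\<close>

lemma r_fadd_less:
  assumes f: "f \<in> functionals" and g: "g \<in> functionals" and "r f < r g"
  shows "r (fadd f g) = r g"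
proof (rule antisym)
  show "r (fadd f g) \<le> r g" using assms by (intro r_fadd_le) auto
  show "r g \<le> r (fadd f g)"
  proof (rule ccontr)
    assume "\<not> r g \<le> r (fadd f g)"
    then have less: "max (r f) (r (fadd f g)) < r g" using assms by auto
    have "r (fadd (fadd f g) f) \<le> max (r f) (r (fadd f g))"
      by (rule r_fadd_le) (use f g in \<open>auto intro: fadd_functional\<close>)
    moreover have "fadd (fadd f g) f = g"
      using fadd_cancel[OF g, of f] by (simp only: fadd_commute[of f g])
    ultimately show False using less by (simp only: leD)
  qed
qed

lemma comb_id_functional: "A \<subseteq> functionals \<Longrightarrow> c \<subseteq> A \<Longrightarrow> comb id c \<in> functionals"
  by (intro comb_functional) auto

text \<open>Adding to \<open>y0\<close> two basis vectors of level \<open>\<beta>\<close> on which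
  all the functionals agree changes no value of these functionals. There are infinitely many such
  perturbations, and each \<open>s\<close> spoils at most one of them.\<close>

lemma ex_generic_vector:
  assumes K: "finite K" "\<And>k. k \<in> K \<Longrightarrow> F k \<in> functionals"
    and \<beta>: "\<beta> < \<alpha>" and S: "finite S" and y0: "\<beta> \<le> v y0"
  shows "\<exists>y. \<beta> \<le> v y \<and> (\<forall>k\<in>K. F k y = F k y0) \<and> (\<forall>s\<in>S. v (y XOR s) \<le> \<beta>)"
proof -
  have "\<forall>n. \<exists>m. lev m = \<beta> \<and> snd (prod_decode m) = n" using ex_lev[OF \<beta>] by metis
  then obtain m where m: "\<And>n. lev (m n) = \<beta>" "\<And>n. snd (prod_decode (m n)) = n" by metis
  have mm: "m n = m n' \<longleftrightarrow> n = n'" for n n' using m(2) by metis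
  \<comment> \<open>The pattern of values on the n-th chosen basis vector. There are finitely many
    patterns, so one of them occurs infinitely often.\<close>
  define col where "col n = restrict (\<lambda>k. F k (2 ^ m n)) K" for n
  have "col n \<in> (\<Pi>\<^sub>E k\<in>K. {0, 1})" for n
    using functional_cases[OF K(2)] unfolding col_def restrict_PiE_iff by blast
  then have "range col \<subseteq> (\<Pi>\<^sub>E k\<in>K. {0, 1})" by (rule image_subsetI)
  then have "finite (range col)" by (rule finite_subset) (use K in \<open>auto intro: finite_PiE\<close>)
  then obtain n0 where N: "infinite {n \<in> UNIV. col n = col n0}"
    using pigeonhole_infinite[of UNIV col] by auto
  define y where "y n = y0 XOR (2 ^ m n0 XOR 2 ^ m n)" for n
  have fin: "finite {n. \<not> v (y n XOR s) \<le> \<beta>}" for s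
  proof -
    let ?B = "{n. \<not> v (y n XOR s) \<le> \<beta>}"
    \<comment> \<open>Two spoilt indices would force the sum of two distinct basis vectors of level
      \<open>\<beta>\<close> to have value above \<open>\<beta>\<close>.\<close>
    have unique: "n = n'" if "n \<in> ?B" "n' \<in> ?B" for n n'
    proof (rule ccontr)
      assume "n \<noteq> n'"
      let ?i = "min (v (y n XOR s)) (v (y n' XOR s))"
      have "?i \<le> v ((y n XOR s) XOR (y n' XOR s))" by (rule le_v_XOR) auto
      moreover have "(y n XOR s) XOR (y n' XOR s) = 2 ^ m n XOR 2 ^ m n'"
        by (rule bit_eqI) (auto simp: y_def bit_xor_iff)
      moreover have "bit (2 ^ m n XOR 2 ^ m n' :: nat) (m n)"
        using \<open>n \<noteq> n'\<close> by (simp add: bit_xor_iff bit_exp_iff mm)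
      ultimately have "?i \<le> lev (m n)" by (metis le_v_iff)
      with that m(1) show False by (simp add: min_le_iff_disj)
    qed
    show ?thesis
    proof (cases "?B = {}")
      case False
      then obtain n where "n \<in> ?B" by blast
      then have "?B \<subseteq> {n}" using unique by (metis insertI1 subsetI)
      then show ?thesis by (rule finite_subset) simp
    qed (simp only: finite.emptyI)
  qed
  have "finite (\<Union>s\<in>S. {n. \<not> v (y n XOR s) \<le> \<beta>})" using S fin by blast
  from Diff_infinite_finite[OF this N]
  obtain n where n: "col n = col n0" "\<And>s. s \<in> S \<Longrightarrow> v (y n XOR s) \<le> \<beta>"
    by (auto dest!: infinite_imp_nonempty)
  have "F k (y n) = F k y0" if "k \<in> K" for k
  proof -
    have "F k (2 ^ m n) = F k (2 ^ m n0)" using n(1) that by (metis col_def restrict_apply')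
    moreover have Fk: "F k \<in> functionals" using K(2) that .
    ultimately show ?thesis
      using functional_cases[OF Fk, of "2 ^ m n0"] functional_mod[OF Fk, of y0]
      by (elim disjE) (simp_all add: y_def functionalD[OF Fk])
  qed
  moreover have "\<beta> \<le> v (y n)"
    unfolding y_def using y0 m(1) by (intro le_v_XOR) (auto simp: v_exp)
  ultimately show ?thesis using n(2) by blast
qed

section \<open>Automorphisms of the filtered space\<close>

abbreviation finv :: "(nat \<Rightarrow> nat) \<Rightarrow> nat \<Rightarrow> nat" where
  "finv \<equiv> inv_into UNIV"

definition aut :: "(nat \<Rightarrow> nat) set" where
  "aut = {g. bij g \<and> (\<forall>x y. g (x XOR y) = g x XOR g y) \<and> (\<forall>x. v (g x) = v x)}"

lemma aut_XOR: "g \<in> aut \<Longrightarrow> g (x XOR y) = g x XOR g y"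
  by (simp add: aut_def)

lemma aut_v: "g \<in> aut \<Longrightarrow> v (g x) = v x"
  by (simp add: aut_def)

lemma aut_bij: "g \<in> aut \<Longrightarrow> bij g"
  by (simp add: aut_def)

lemma aut_inv_f [simp]: "g \<in> aut \<Longrightarrow> finv g (g x) = x" "g \<in> aut \<Longrightarrow> g (finv g x) = x"
  by (simp_all add: aut_bij bij_is_inj bij_is_surj surj_f_inv_f)

lemma id_aut: "id \<in> aut"
  by (simp add: aut_def)

lemma comp_aut: "g \<in> aut \<Longrightarrow> h \<in> aut \<Longrightarrow> g \<circ> h \<in> aut"
  by (simp add: aut_def bij_comp)

lemma inv_aut:
  assumes "g \<in> aut"
  shows "finv g \<in> aut"
proof -
  have "finv g (x XOR y) = finv g x XOR finv g y" for x y
    using assms by (metis aut_inv_f aut_XOR)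
  moreover have "v (finv g x) = v x" for x using assms by (metis aut_inv_f(2) aut_v)
  ultimately show ?thesis using aut_bij[OF assms] by (simp add: aut_def bij_imp_bij_inv)
qed

lemma functional_comp: "f \<in> functionals \<Longrightarrow> g \<in> aut \<Longrightarrow> f \<circ> g \<in> functionals"
  by (simp add: functionals_def aut_XOR)

lemma r_comp:
  assumes "f \<in> functionals" "g \<in> aut"
  shows "r (f \<circ> g) = r f"
proof -
  have "(\<forall>x. i \<le> v x \<longrightarrow> f (g x) = 0) \<longleftrightarrow> (\<forall>x. i \<le> v x \<longrightarrow> f x = 0)" for i
    using aut_v[OF assms(2)] aut_inv_f[OF assms(2)] by metis
  then show ?thesis by (simp add: r_def)
qed

text \<open>The map adds \<open>w\<close> times the \<open>m\<close>-th coordinate. As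
  \<open>w\<close> lacks the bit \<open>m\<close>, this is an involution. As \<open>w\<close> has
  value at least \<open>lev m\<close>, it never lowers \<open>v\<close>, and being an involution it
  preserves \<open>v\<close>.\<close>

lemma transvection:
  assumes "\<not> bit w m" "lev m \<le> v w"
  defines "u \<equiv> \<lambda>x. if bit x m then x XOR w else x"
  shows "u \<in> aut" "u (u x) = x"
proof -
  have uu: "u (u x) = x" for x
    using assms(1) by (auto simp: u_def bit_xor_iff xor.assoc)
  then show "u (u x) = x" .
  have "bij u" using uu by (intro o_bij[of u u]) auto
  moreover have "u (x XOR y) = u x XOR u y" for x y
    by (auto simp: u_def bit_xor_iff xor.assoc xor.left_commute xor.commute)
  moreover have le: "v x \<le> v (u x)" for x
    unfolding u_def using assms(2) le_v_iff[of "v x" x] by (auto intro!: le_v_XOR)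
  then have "v (u x) = v x" for x
    using le[of "u x"] uu by (simp add: antisym)
  ultimately show "u \<in> aut" by (simp add: aut_def)
qed

section \<open>Back and forth between finite partial isomorphisms\<close>

text \<open>Finite partial isomorphisms, as subgroups of pairs: being functional and injective is a
  consequence of preserving \<^term>\<open>v\<close>.\<close>

definition partial_iso ::
    "'k set \<Rightarrow> ('k \<Rightarrow> nat \<Rightarrow> nat) \<Rightarrow> ('k \<Rightarrow> nat \<Rightarrow> nat) \<Rightarrow> (nat \<times> nat) set \<Rightarrow> bool" where
  "partial_iso K F F' P \<longleftrightarrow> finite P \<and> (0, 0) \<in> P \<and>
     (\<forall>x y x' y'. (x, y) \<in> P \<longrightarrow> (x', y') \<in> P \<longrightarrow> (x XOR x', y XOR y') \<in> P) \<and>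
     (\<forall>x y. (x, y) \<in> P \<longrightarrow> v x = v y \<and> (\<forall>k\<in>K. F k x = F' k y))"

lemma partial_iso_converse: "partial_iso K F F' P \<Longrightarrow> partial_iso K F' F (P\<inverse>)"
  unfolding partial_iso_def by auto

text \<open>The forth step. The new vector is first moved to a representative \<open>x1\<close> of
  maximal value in its coset of \<open>Domain P\<close>; its partner \<open>y\<close> is found by
  solving a linear system and making the solution generic. Both then satisfy the same formula
  \<open>min \<beta> (v s)\<close> for the values on their cosets.\<close>

lemma partial_iso_extend:
  assumes K: "finite K" "\<And>k. k \<in> K \<Longrightarrow> F k \<in> functionals" "\<And>k. k \<in> K \<Longrightarrow> F' k \<in> functionals"
    and eq: "\<And>c. c \<subseteq> K \<Longrightarrow> r (comb F c) = r (comb F' c)"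
    and P: "partial_iso K F F' P"
  shows "\<exists>P'. partial_iso K F F' P' \<and> P \<subseteq> P' \<and> x \<in> Domain P'"
proof (cases "x \<in> Domain P")
  case True
  with P show ?thesis by blast
next
  case False
  have finP: "finite P" and P0: "(0, 0) \<in> P"
    and PX: "\<And>x y x' y'. (x, y) \<in> P \<Longrightarrow> (x', y') \<in> P \<Longrightarrow> (x XOR x', y XOR y') \<in> P"
    and Pv: "\<And>x y. (x, y) \<in> P \<Longrightarrow> v x = v y"
    and PF: "\<And>x y k. (x, y) \<in> P \<Longrightarrow> k \<in> K \<Longrightarrow> F k x = F' k y"
    using P unfolding partial_iso_def by blast+
  let ?V = "(\<lambda>s. v (x XOR s)) ` Domain P"
  have V: "finite ?V" "?V \<noteq> {}" using finP P0 by (auto simp: finite_Domain)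
  from Max_in[OF V] obtain s0 where s0: "s0 \<in> Domain P" "v (x XOR s0) = Max ?V" by (metis (mono_tags, lifting) imageE)
  define x1 where "x1 = x XOR s0"
  define \<beta> where "\<beta> = v x1"
  have "x1 \<noteq> 0" using False s0(1) XOR_eq_0_iff unfolding x1_def by metis
  then have \<beta>: "\<beta> < \<alpha>" unfolding \<beta>_def by (rule v_less_top)
  have max: "v (x1 XOR s) \<le> \<beta>" if "(s, s') \<in> P" for s s'
  proof -
    have "s0 XOR s \<in> Domain P" using that s0(1) PX by blast
    then have "v (x XOR (s0 XOR s)) \<le> Max ?V" using V(1) by (intro Max_ge) auto
    then show ?thesis by (simp add: x1_def \<beta>_def s0(2) xor.assoc)
  qed
  \<comment> \<open>The hypothesis on \<open>r\<close> gives consistency: a sum of the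
    \<open>F' k\<close> that vanishes on all vectors of value at least \<open>\<beta>\<close> has
    \<open>r\<close> at most \<open>\<beta>\<close>, so the same sum of the \<open>F k\<close>
    vanishes at \<open>x1\<close>.\<close>
  have "\<exists>y0\<in>{y. \<beta> \<le> v y}. \<forall>k\<in>K. F' k y0 = F k x1 mod 2"
  proof (rule linear_system_solvable[OF K(1,3)])
    fix c assume c: "c \<subseteq> K" "\<And>y. y \<in> {y. \<beta> \<le> v y} \<Longrightarrow> comb F' c y = 0"
    have cf: "comb F c \<in> functionals" "comb F' c \<in> functionals"
      using c(1) K by (auto intro!: comb_functional)
    have "r (comb F' c) \<le> \<beta>" using c(2) cf by (simp add: r_le_iff)
    then have "r (comb F c) \<le> \<beta>" using eq c(1) by simp
    then have "comb F c x1 = 0" using cf by (simp add: r_le_iff \<beta>_def)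
    then show "(\<Sum>k\<in>c. F k x1) mod 2 = 0" by (simp add: comb_def)
  qed (use \<beta> in \<open>auto intro: le_v_XOR\<close>)
  then obtain y0 where y0: "\<beta> \<le> v y0" "\<And>k. k \<in> K \<Longrightarrow> F' k y0 = F k x1"
    using K(2) functional_mod by auto
  \<comment> \<open>Genericity over \<open>Range P\<close> gives \<open>y\<close> the maximality in
    its coset that \<open>x1\<close> has by choice.\<close>
  from ex_generic_vector[of K F', OF K(1,3) \<beta> finite_Range[OF finP] y0(1)]
  obtain y where y: "\<beta> \<le> v y" "\<And>k. k \<in> K \<Longrightarrow> F' k y = F' k y0"
      "\<And>s. s \<in> Range P \<Longrightarrow> v (y XOR s) \<le> \<beta>" by blast
  have "v y \<le> \<beta>" using y(3)[of 0] P0 by (simp add: Range.intros)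
  with y(1) have vy: "v y = \<beta>" by simp
  have vXOR: "v (z XOR s) = min \<beta> (v s)" if "v z = \<beta>" "v (z XOR s) \<le> \<beta>" for z s
  proof (cases "v s < \<beta>")
    case True
    then show ?thesis using v_XOR_less[of s z] that by (simp add: xor.commute)
  next
    case False
    then show ?thesis using le_v_XOR[of \<beta> z s] that by (simp add: antisym)
  qed
  have v_eq: "v (x1 XOR s) = v (y XOR s')" if "(s, s') \<in> P" for s s'
    using vXOR[of x1 s] vXOR[of y s'] max[OF that] y(3)[of s'] Pv[OF that] that vy \<beta>_def
    by (simp add: Range.intros)
  have F_eq: "F k (x1 XOR s) = F' k (y XOR s')" if "(s, s') \<in> P" "k \<in> K" for s s' k
    using PF[OF that] y(2) y0(2) K(2,3) that(2) by (simp add: functionalD)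
  \<comment> \<open>\<open>P \<union> ?Q\<close> is the subgroup generated by \<open>P\<close> and
    the pair \<open>(x1, y)\<close>.\<close>
  let ?Q = "(\<lambda>(s, s'). (x1 XOR s, y XOR s')) ` P"
  have shape: "\<exists>i s s'. (s, s') \<in> P \<and> a = (if i then x1 else 0) XOR s \<and> b = (if i then y else 0) XOR s'"
    if "(a, b) \<in> P \<union> ?Q" for a b
    using that
  proof
    assume "(a, b) \<in> P"
    then show ?thesis by (intro exI[of _ False] exI[of _ a] exI[of _ b]) simp
  next
    assume "(a, b) \<in> ?Q"
    then obtain s s' where "(s, s') \<in> P" "a = x1 XOR s" "b = y XOR s'" by auto
    then show ?thesis by (intro exI[of _ True] exI[of _ s] exI[of _ s']) simp
  qed
  have Q: "(a XOR a', b XOR b') \<in> P \<union> ?Q" if ab: "(a, b) \<in> P \<union> ?Q" "(a', b') \<in> P \<union> ?Q" for a b a' b'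
  proof -
    obtain i s s' where 1: "(s, s') \<in> P" "a = (if i then x1 else 0) XOR s" "b = (if i then y else 0) XOR s'"
      using shape[OF ab(1)] by blast
    obtain j t t' where 2: "(t, t') \<in> P" "a' = (if j then x1 else 0) XOR t" "b' = (if j then y else 0) XOR t'"
      using shape[OF ab(2)] by blast
    have "a XOR a' = (if i \<noteq> j then x1 else 0) XOR (s XOR t)" "b XOR b' = (if i \<noteq> j then y else 0) XOR (s' XOR t')"
      unfolding 1(2,3) 2(2,3) by (cases i; cases j; simp add: xor.assoc xor.left_commute xor.commute)+
    moreover have "(s XOR t, s' XOR t') \<in> P" using PX 1(1) 2(1) by blast
    ultimately show ?thesis
      by (cases "i = j") (simp, auto intro!: image_eqI[of _ _ "(s XOR t, s' XOR t')"])
  qed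
  have "partial_iso K F F' (P \<union> ?Q)"
    unfolding partial_iso_def
  proof (intro conjI allI impI ballI)
    show "finite (P \<union> ?Q)" "(0, 0) \<in> P \<union> ?Q" using finP P0 by auto
    fix a b assume ab: "(a, b) \<in> P \<union> ?Q"
    then show "v a = v b" using Pv v_eq by auto
    show "F k a = F' k b" if "k \<in> K" for k using ab PF F_eq that by auto
  next
    fix a b a' b' assume "(a, b) \<in> P \<union> ?Q" "(a', b') \<in> P \<union> ?Q"
    then show "(a XOR a', b XOR b') \<in> P \<union> ?Q" by (rule Q)
  qed
  moreover have "x \<in> Domain ?Q"
  proof -
    from s0(1) obtain s' where "(s0, s') \<in> P" by blast
    moreover have "x1 XOR s0 = x" by (simp add: x1_def xor.assoc)
    ultimately show ?thesis by force
  qed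
  ultimately show ?thesis by (intro exI[of _ "P \<union> ?Q"]) auto
qed

text \<open>Back and forth along the enumeration of all vectors, starting from the zero pair; the
  union of the chain is the graph of an automorphism. As automorphisms preserve \<open>r\<close>,
  its values on all sums are a complete invariant of the orbit.\<close>

lemma same_orbit:
  assumes K: "finite K" "\<And>k. k \<in> K \<Longrightarrow> F k \<in> functionals" "\<And>k. k \<in> K \<Longrightarrow> F' k \<in> functionals"
    and eq: "\<And>c. c \<subseteq> K \<Longrightarrow> r (comb F c) = r (comb F' c)"
  shows "\<exists>g\<in>aut. \<forall>k\<in>K. F k \<circ> finv g = F' k"
proof -
  have ext: "\<exists>Q. partial_iso K F F' Q \<and> P \<subseteq> Q \<and> n \<in> Domain Q \<and> n \<in> Range Q"
    if P: "partial_iso K F F' P" for P n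
  proof -
    from partial_iso_extend[OF K eq P, of n] obtain Q
      where Q: "partial_iso K F F' Q" "P \<subseteq> Q" "n \<in> Domain Q" by auto
    from partial_iso_extend[OF K(1,3,2) eq[symmetric] partial_iso_converse[OF Q(1)], of n] obtain R
      where R: "partial_iso K F' F R" "Q\<inverse> \<subseteq> R" "n \<in> Domain R" by auto
    have "partial_iso K F F' (R\<inverse>)" using partial_iso_converse[OF R(1)] .
    moreover have "Q \<subseteq> R\<inverse>" using R(2) by auto
    ultimately show ?thesis using Q(2,3) R(3) by (intro exI[of _ "R\<inverse>"]) auto
  qed
  have "\<exists>f. \<forall>n. partial_iso K F F' (f n) \<and> (f n \<subseteq> f (Suc n) \<and> n \<in> Domain (f (Suc n)) \<and> n \<in> Range (f (Suc n)))"
  proof (rule dependent_nat_choice)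
    have "partial_iso K F F' {(0, 0)}"
      using K by (auto simp: partial_iso_def functional_0)
    then show "\<exists>P. partial_iso K F F' P" by blast
  qed (use ext in blast)
  then obtain f where f: "\<And>n. partial_iso K F F' (f n)" "\<And>n. f n \<subseteq> f (Suc n)"
      "\<And>n. n \<in> Domain (f (Suc n))" "\<And>n. n \<in> Range (f (Suc n))" by blast
  define R where "R = (\<Union>n. f n)"
  have R1: "v x = v y" "k \<in> K \<Longrightarrow> F k x = F' k y" if "(x, y) \<in> R" for x y k
    using that f(1) unfolding R_def partial_iso_def by blast+
  have RX: "(x XOR x', y XOR y') \<in> R" if "(x, y) \<in> R" "(x', y') \<in> R" for x y x' y'
  proof -
    from that obtain m n where "(x, y) \<in> f m" "(x', y') \<in> f n" by (auto simp: R_def)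
    moreover have "f i \<subseteq> f j" if "i \<le> j" for i j
      using f(2) that by (rule lift_Suc_mono_le)
    ultimately have "(x, y) \<in> f (max m n)" "(x', y') \<in> f (max m n)"
      by (meson max.cobounded1 max.cobounded2 subsetD)+
    then have "(x XOR x', y XOR y') \<in> f (max m n)"
      using f(1)[of "max m n"] unfolding partial_iso_def by blast
    then show ?thesis by (auto simp: R_def)
  qed
  \<comment> \<open>Only the zero vector has value \<open>\<alpha>\<close>, so preservation of
    \<open>v\<close> makes the relation single-valued and injective.\<close>
  have R_iff: "x = x' \<longleftrightarrow> y = y'" if "(x, y) \<in> R" "(x', y') \<in> R" for x y x' y'
    using R1(1)[OF RX[OF that]] by (metis XOR_eq_0_iff v_eq_top_iff)
  have "\<forall>x. \<exists>y. (x, y) \<in> R" using f(3) unfolding R_def by blast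
  then obtain g where g: "\<And>x. (x, g x) \<in> R" by metis
  have g_eq: "(x, y) \<in> R \<longleftrightarrow> y = g x" for x y using g R_iff by blast
  have "\<exists>x. (x, y) \<in> R" for y using f(4) unfolding R_def by blast
  then have "surj g" using g_eq by (metis surj_def)
  moreover have "inj g" using g R_iff by (metis injI)
  ultimately have "g \<in> aut"
    using RX[OF g g] R1(1)[OF g] g_eq by (simp add: aut_def bij_def)
  moreover have "F k \<circ> finv g = F' k" if "k \<in> K" for k
  proof
    fix y
    have "(finv g y, y) \<in> R" using g[of "finv g y"] \<open>g \<in> aut\<close> by simp
    then show "(F k \<circ> finv g) y = F' k y" using R1(2) that by simp
  qed
  ultimately show ?thesis by blast
qed

end

section \<open>The action and the ranks over finite sets\<close>

context flag
begin

definition Aut :: "(nat \<Rightarrow> nat) monoid" where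
  "Aut = \<lparr>carrier = aut, mult = (\<circ>), one = id\<rparr>"

lemma Aut_simps [simp]: "carrier Aut = aut" "mult Aut = (\<circ>)" "one Aut = id"
  by (simp_all add: Aut_def)

lemma finv_comp: "g \<in> aut \<Longrightarrow> finv g \<circ> g = id" "g \<in> aut \<Longrightarrow> g \<circ> finv g = id"
  by (simp_all add: fun_eq_iff)

lemma group_Aut: "group Aut"
proof (rule groupI)
  fix g assume "g \<in> carrier Aut"
  then show "\<exists>h\<in>carrier Aut. h \<otimes>\<^bsub>Aut\<^esub> g = \<one>\<^bsub>Aut\<^esub>"
    using inv_aut finv_comp by auto
qed (auto simp: comp_aut id_aut comp_assoc)

lemma inv_Aut: "g \<in> aut \<Longrightarrow> m_inv Aut g = finv g"
  using group_Aut by (intro group.inv_equality) (auto simp: finv_comp inv_aut)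

lemma finv_o: "g \<in> aut \<Longrightarrow> h \<in> aut \<Longrightarrow> finv (g \<circ> h) = finv h \<circ> finv g"
  by (simp add: o_inv_distrib aut_bij)

text \<open>Composition with the inverse gives a left action. The restriction makes
  \<open>act g\<close> extensional, as membership in \<open>BijGroup\<close> demands.\<close>

definition act :: "(nat \<Rightarrow> nat) \<Rightarrow> (nat \<Rightarrow> nat) \<Rightarrow> nat \<Rightarrow> nat" where
  "act g = (\<lambda>f\<in>functionals. f \<circ> finv g)"

lemma act_eq [simp]: "f \<in> functionals \<Longrightarrow> act g f = f \<circ> finv g"
  by (simp add: act_def)

lemma act_functional: "g \<in> aut \<Longrightarrow> f \<in> functionals \<Longrightarrow> f \<circ> finv g \<in> functionals"
  by (simp add: functional_comp inv_aut)

lemma r_act: "g \<in> aut \<Longrightarrow> f \<in> functionals \<Longrightarrow> r (f \<circ> finv g) = r f"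
  by (simp add: r_comp inv_aut)

section \<open>Stabilizers and the rank over a finite set\<close>

definition fixing :: "(nat \<Rightarrow> nat) set \<Rightarrow> (nat \<Rightarrow> nat) set" where
  "fixing A = {g \<in> aut. \<forall>f\<in>A. f \<circ> finv g = f}"

lemma pointwise_stabilizer_eq:
  "A \<subseteq> functionals \<Longrightarrow> pointwise_stabilizer Aut act A = fixing A"
  unfolding pointwise_stabilizer_def fixing_def by (metis (no_types, opaque_lifting) Aut_simps(1) act_eq subsetD)

lemma comp_finv_eq_iff: "g \<in> aut \<Longrightarrow> f \<circ> finv g = f' \<longleftrightarrow> (\<forall>x. f x = f' (g x))"
  by (metis aut_inv_f comp_apply ext)

lemma comb_id_comp: "g \<in> fixing A \<Longrightarrow> c \<subseteq> A \<Longrightarrow> comb id c \<circ> finv g = comb id c"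
  unfolding fixing_def comb_def
  by (auto simp: fun_eq_iff subset_iff intro!: arg_cong[where f = "\<lambda>n. n mod 2"] sum.cong)

definition rk :: "(nat \<Rightarrow> nat) \<Rightarrow> (nat \<Rightarrow> nat) set \<Rightarrow> 'o" where
  "rk h A = (LEAST i. \<exists>c\<subseteq>A. r (fadd h (comb id c)) \<le> i)"

lemma rk_le: "c \<subseteq> A \<Longrightarrow> rk h A \<le> r (fadd h (comb id c))"
  unfolding rk_def by (rule Least_le) auto

lemma rk_attained: "\<exists>c\<subseteq>A. r (fadd h (comb id c)) = rk h A"
proof -
  have "\<exists>c\<subseteq>A. r (fadd h (comb id c)) \<le> rk h A"
    unfolding rk_def by (rule LeastI_ex) auto
  then show ?thesis using rk_le by (metis antisym)
qed

lemma rk_antimono: "A \<subseteq> B \<Longrightarrow> rk h B \<le> rk h A"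
  using rk_attained[of A h] rk_le[of _ B h] by (metis subset_trans)

lemma rk_empty: "h \<in> functionals \<Longrightarrow> rk h {} = r h"
  using rk_attained[of "{}" h] by (simp add: fadd_zero fadd_commute[of h])

lemma rk_le_top: "h \<in> functionals \<Longrightarrow> rk h A \<le> \<alpha>"
  using rk_antimono[of "{}" A h] rk_empty[of h] r_le_top[of h] by simp

text \<open>The functional \<open>k n\<close> adds up the coordinates numbered \<open>n\<close> at
  all levels below \<open>\<gamma>\<close>. By pigeonhole, if all of them came closer than
  \<open>\<gamma>\<close> to the finite span of \<open>A\<close>, two would do so at the same
  combination; their sum would have \<open>r\<close> below \<open>\<gamma>\<close>, although it is
  nonzero on basis vectors of every level below \<open>\<gamma>\<close>.\<close>

lemma ex_generic_functional:
  assumes \<gamma>: "\<gamma> \<le> \<alpha>" and A: "finite A" "A \<subseteq> functionals"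
  shows "\<exists>k\<in>functionals. r k \<le> \<gamma> \<and> (\<forall>c\<subseteq>A. \<gamma> \<le> r (fadd k (comb id c)))"
proof -
  define k where "k n = parity {m. lev m < \<gamma> \<and> snd (prod_decode m) = n}" for n
  have kf: "k n \<in> functionals" for n by (simp add: k_def parity_functional)
  have "k n x = 0" if "\<gamma> \<le> v x" for n x
  proof -
    have "bits x \<inter> {m. lev m < \<gamma> \<and> snd (prod_decode m) = n} = {}"
      using that by (auto simp: le_v_iff dest: leD)
    then show ?thesis by (simp add: k_def parity_def)
  qed
  then have rk: "r (k n) \<le> \<gamma>" for n by (simp add: r_le_iff kf)
  have "\<exists>n. \<forall>c\<subseteq>A. \<gamma> \<le> r (fadd (k n) (comb id c))"
  proof (rule ccontr)
    assume "\<not> ?thesis"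
    then have "\<forall>n. \<exists>c\<subseteq>A. r (fadd (k n) (comb id c)) < \<gamma>" by (auto simp: not_le)
    then obtain c where c: "\<And>n. c n \<subseteq> A" "\<And>n. r (fadd (k n) (comb id (c n))) < \<gamma>" by metis
    have "range c \<subseteq> Pow A" using c(1) by auto
    then have "finite (range c)" using A(1) by (rule finite_subset[OF _ finite_Pow_iff[THEN iffD2]])
    then have "\<not> inj c" using finite_imageD by blast
    then obtain n n' where n: "n \<noteq> n'" "c n = c n'" by (auto simp: inj_def)
    define \<delta> where "\<delta> = max (r (fadd (k n) (comb id (c n)))) (r (fadd (k n') (comb id (c n))))"
    have \<delta>: "\<delta> < \<gamma>" using c(2)[of n] c(2)[of n'] n(2) by (simp add: \<delta>_def)
    have cf: "comb id (c n) \<in> functionals" using c(1) A(2) by (rule comb_id_functional[rotated])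
    have "r (fadd (fadd (k n) (comb id (c n))) (fadd (k n') (comb id (c n)))) \<le> \<delta>"
      by (rule r_fadd_le) (use kf cf in \<open>auto simp: \<delta>_def fadd_functional\<close>)
    also have "fadd (fadd (k n) (comb id (c n))) (fadd (k n') (comb id (c n))) = fadd (k n) (k n')"
      using fadd_cancel[OF kf] by (metis fadd_assoc fadd_commute)
    finally have le: "r (fadd (k n) (k n')) \<le> \<delta>" .
    obtain m where m: "lev m = \<delta>" "snd (prod_decode m) = n"
      using ex_lev[of \<delta> n] \<delta> \<gamma> by (metis order_less_le_trans)
    have "fadd (k n) (k n') (2 ^ m) = 0"
      using le m(1) by (simp add: r_le_iff fadd_functional kf v_exp)
    then show False using m n(1) \<delta> by (simp add: fadd_def k_def parity_exp)
  qed
  then show ?thesis using kf rk by blast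
qed

text \<open>Adjoin \<open>fadd h k\<close> with \<open>k\<close> generic of value
  \<open>\<gamma>\<close> over \<open>A\<close>. Then \<open>k\<close> lies in the coset of
  \<open>h\<close>, so the rank falls to at most \<open>\<gamma>\<close>. It falls no further:
  combinations using the new element are bounded below by genericity, the others by
  \<open>rk h A\<close>.\<close>

lemma rk_drop:
  assumes h: "h \<in> functionals" and A: "finite A" "A \<subseteq> functionals" and less: "\<gamma> < rk h A"
  shows "\<exists>B. finite B \<and> A \<subseteq> B \<and> B \<subseteq> functionals \<and> rk h B < rk h A \<and> \<gamma> \<le> rk h B"
proof -
  have "\<gamma> \<le> \<alpha>" using less rk_le_top[OF h, of A] by (meson less_imp_le order_trans)
  from ex_generic_functional[OF this A] obtain k
    where k: "k \<in> functionals" "r k \<le> \<gamma>" "\<And>c. c \<subseteq> A \<Longrightarrow> \<gamma> \<le> r (fadd k (comb id c))" by blast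
  let ?b = "fadd h k" and ?B = "insert (fadd h k) A"
  have hb: "fadd h ?b = k" using fadd_cancel[OF k(1), of h] by (metis fadd_assoc fadd_commute)
  have "comb id {?b} = ?b"
    using fadd_functional[OF h k(1)] by (simp add: comb_def functional_mod)
  then have "rk h ?B \<le> r k" using rk_le[of "{?b}" ?B h] hb by simp
  moreover have "\<gamma> \<le> rk h ?B"
  proof -
    obtain c where c: "c \<subseteq> ?B" "r (fadd h (comb id c)) = rk h ?B" using rk_attained by blast
    show ?thesis
    proof (cases "?b \<in> c")
      case True
      then have "comb id c = fadd ?b (comb id (c - {?b}))"
        using comb_insert[of "c - {?b}" ?b id] c(1) A(1) finite_subset
        by (metis Diff_iff finite_Diff finite_insert id_apply insertI1 insert_Diff)
      then have "fadd h (comb id c) = fadd k (comb id (c - {?b}))"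
        using hb by (metis fadd_assoc)
      then show ?thesis using k(3)[of "c - {?b}"] c by (metis Diff_subset_conv insert_is_Un)
    next
      case False
      then have "c \<subseteq> A" using c(1) by blast
      then show ?thesis using rk_le[of c A h] c(2) less by (metis less_imp_le order_trans)
    qed
  qed
  ultimately show ?thesis
    using k less A h by (intro exI[of _ ?B]) (auto intro: fadd_functional)
qed

text \<open>The transvection in direction \<open>w\<close> fixes \<open>A\<close> and every vector without the bit \<open>m\<close>, but
  moves \<open>h\<close> by a functional that does not vanish at level \<open>\<gamma>\<close>.\<close>

lemma move_off_coset:
  assumes h: "h \<in> functionals" and A: "finite A" "A \<subseteq> functionals" and less: "\<gamma> < rk h A"
    and d: "d \<in> functionals" and g0: "g0 \<in> fixing A" and S: "finite S"
  shows "\<exists>g\<in>fixing A. (\<forall>s\<in>S. g s = g0 s) \<and> \<not> r (fadd (h \<circ> finv g) d) \<le> \<gamma>"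
proof (cases "r (fadd (h \<circ> finv g0) d) \<le> \<gamma>")
  case False
  with g0 show ?thesis by blast
next
  case True
  have g0a: "g0 \<in> aut" using g0 by (simp add: fixing_def)
  have "\<gamma> < \<alpha>" using less rk_le_top[OF h, of A] by (rule order_less_le_trans)
  let ?F = "case_option h id" and ?K = "insert None (Some ` A)"
  let ?t = "\<lambda>k. if k = None then 1 else 0 :: nat"
  have "\<exists>w\<in>{w. \<gamma> \<le> v w}. \<forall>k\<in>?K. ?F k w = ?t k mod 2"
  proof (rule linear_system_solvable)
    fix c assume c: "c \<subseteq> ?K" and van: "\<And>x. x \<in> {w. \<gamma> \<le> v w} \<Longrightarrow> comb ?F c x = 0"
    have fc: "finite c" using A(1) by (intro finite_subset[OF c]) simp
    have cA: "Some -` c \<subseteq> A" using c by auto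
    \<comment> \<open>A relation involving \<open>h\<close> would be a member of the coset of
      \<open>h\<close> modulo the span of \<open>A\<close> with \<open>r\<close> at most
      \<open>\<gamma>\<close>, against \<open>\<gamma> < rk h A\<close>. Relations among members of
      \<open>A\<close> alone have right-hand side 0.\<close>
    have "None \<notin> c"
    proof
      assume "None \<in> c"
      then have eq: "comb ?F c = fadd h (comb id (Some -` c))" using comb_option[OF fc] by simp
      have "comb ?F c \<in> functionals"
        unfolding eq using h A(2) cA by (intro fadd_functional comb_id_functional)
      then have "r (comb ?F c) \<le> \<gamma>" using van by (simp add: r_le_iff)
      moreover have "rk h A \<le> r (comb ?F c)" unfolding eq using cA by (rule rk_le)
      ultimately show False using less by (meson leD order_trans)
    qed
    then have "(\<Sum>k\<in>c. ?t k) = 0" by (intro sum.neutral) (metis (full_types))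
    then show "(\<Sum>k\<in>c. ?t k) mod 2 = 0" by simp
  qed (use h A \<open>\<gamma> < \<alpha>\<close> in \<open>auto intro: le_v_XOR\<close>)
  then obtain w where w: "\<gamma> \<le> v w" "h w = 1" "\<And>a. a \<in> A \<Longrightarrow> a w = 0" by auto
  have "w \<noteq> 0" using w(2) functional_0[OF h] by (intro notI) simp
  then have "v w < \<alpha>" by (rule v_less_top)
  then have "\<forall>n. \<exists>m. lev m = v w \<and> snd (prod_decode m) = n" using ex_lev by metis
  then obtain f where f: "\<And>n. lev (f n) = v w" "\<And>n. snd (prod_decode (f n)) = n" by metis
  have "inj f" using f(2) by (metis injI)
  then have "infinite (range f)" by (simp add: finite_image_iff)
  moreover have "finite (\<Union>s\<in>insert w S. bits s)" using S by simp
  ultimately have "\<not> range f \<subseteq> (\<Union>s\<in>insert w S. bits s)" using finite_subset by metis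
  \<comment> \<open>Infinitely many basis vectors share the level of \<open>w\<close>, so one of
    them occurs neither in \<open>w\<close> nor in any vector of \<open>S\<close>.\<close>
  then obtain m where m: "m \<in> range f" "m \<notin> (\<Union>s\<in>insert w S. bits s)" by blast
  have mw: "\<not> bit w m" and mS: "\<And>s. s \<in> S \<Longrightarrow> \<not> bit s m" and lm: "lev m = v w"
    using m f(1) by auto
  define u where "u x = (if bit x m then x XOR w else x)" for x
  have "u = (\<lambda>x. if bit x m then x XOR w else x)" by (simp add: u_def fun_eq_iff)
  then have ua: "u \<in> aut" and uu: "\<And>x. u (u x) = x"
    using transvection[OF mw eq_refl[OF lm]] by auto
  have "finv u = u" by (rule inv_equality) (rule uu)+
  define g where "g = g0 \<circ> u"
  have ga: "g \<in> aut" using g0a ua by (simp add: g_def comp_aut)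
  have finv_g: "finv g = u \<circ> finv g0" using finv_o[OF g0a ua] \<open>finv u = u\<close> by (simp add: g_def)
  have "a \<circ> finv g = a" if "a \<in> A" for a
  proof -
    have af: "a \<in> functionals" using that A(2) by blast
    have "a \<circ> u = a"
      using w(3)[OF that] by (auto simp: u_def fun_eq_iff functionalD[OF af] functional_mod[OF af])
    moreover have "a \<circ> finv g0 = a" using g0 that by (simp add: fixing_def)
    ultimately show ?thesis by (simp add: finv_g flip: comp_assoc)
  qed
  then have gfix: "g \<in> fixing A" using ga by (simp add: fixing_def)
  have gS: "g s = g0 s" if "s \<in> S" for s using mS[OF that] by (simp add: g_def u_def)
  \<comment> \<open>At this vector \<open>finv g\<close> and \<open>finv g0\<close> differ by
    \<open>w\<close>, so \<open>h\<close> takes different values and the functional no longer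
    vanishes.\<close>
  let ?z = "g0 (2 ^ m)"
  have vz: "\<gamma> \<le> v ?z" using w(1) lm by (simp add: aut_v[OF g0a] v_exp)
  have "(h (2 ^ m) + d ?z) mod 2 = 0"
  proof -
    have "fadd (h \<circ> finv g0) d ?z = 0"
      using True vz h d g0a by (simp add: r_le_iff fadd_functional act_functional)
    then show ?thesis using g0a by (simp add: fadd_def)
  qed
  then have "fadd (h \<circ> finv g) d ?z \<noteq> 0"
    using g0a functional_cases[OF h, of "2 ^ m"] w(2)
    by (auto simp: fadd_def finv_g u_def functionalD[OF h] bit_exp_iff mod2_eq_if split: if_splits)
  then have "\<not> r (fadd (h \<circ> finv g) d) \<le> \<gamma>"
    using vz h d ga by (auto simp: r_le_iff fadd_functional act_functional)
  with gfix gS show ?thesis by blast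
qed

section \<open>Category\<close>

lemma closed_aut_conditions:
  "closed {g. (\<forall>x y. g (x XOR y) = g x XOR g y) \<and> (\<forall>x. v (g x) = v x)}"
proof (intro closed_Collect_conj closed_Collect_all)
  show "closed {g :: nat \<Rightarrow> nat. g (x XOR y) = g x XOR g y}" for x y
    by (rule open_seq_local(2)[of "{x, y, x XOR y}"]) auto
  show "closed {g :: nat \<Rightarrow> nat. v (g x) = v x}" for x
    by (rule open_seq_local(2)[of "{x}"]) auto
qed

text \<open>Injectivity follows from additivity and preservation of \<open>v\<close>. What remains
  is a closed condition together with surjectivity, a countable intersection of open conditions, so
  the group is a G-delta set.\<close>

lemma aut_eq:
  "aut = {g. (\<forall>x y. g (x XOR y) = g x XOR g y) \<and> (\<forall>x. v (g x) = v x)} \<inter>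
     (\<Inter>y. {g. \<exists>x. g x = y})"
proof -
  have "inj g" if g: "\<And>x y. g (x XOR y) = g x XOR g y" "\<And>x. v (g x) = v x" for g
  proof (rule injI)
    fix x y assume "g x = g y"
    then have "v (x XOR y) = \<alpha>" using g by (metis v_0 xor_self_eq)
    then show "x = y" by (simp add: v_eq_top_iff XOR_eq_0_iff)
  qed
  then show ?thesis unfolding aut_def bij_def surj_def by auto metis+
qed

lemma closed_fixing_condition: "closed {g. \<forall>f\<in>A. \<forall>x. f x = (f :: nat \<Rightarrow> nat) (g x)}"
proof -
  have "closed {g. \<forall>f x. f \<in> A \<longrightarrow> f x = (f :: nat \<Rightarrow> nat) (g x)}"
  proof (intro closed_Collect_all)
    show "closed {g. f \<in> A \<longrightarrow> f x = f (g x)}" for f :: "nat \<Rightarrow> nat" and x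
      by (rule open_seq_local(2)[of "{x}"]) auto
  qed
  then show ?thesis by (simp add: Ball_def)
qed

lemma fixing_eq: "fixing A = aut \<inter> {g. \<forall>f\<in>A. \<forall>x. f x = f (g x)}"
  unfolding fixing_def by (auto simp: comp_finv_eq_iff)

lemma fixing_empty: "fixing {} = aut"
  by (simp add: fixing_def)

lemma completely_metrizable_fixing: "completely_metrizable_space (top_of_set (fixing A))"
proof (rule completely_metrizable_top_of_set)
  show "closed ({g. (\<forall>x y. g (x XOR y) = g x XOR g y) \<and> (\<forall>x. v (g x) = v x)} \<inter>
      {g. \<forall>f\<in>A. \<forall>x. f x = f (g x)})"
    by (intro closed_Int closed_aut_conditions closed_fixing_condition)
  show "open U" if "U \<in> range (\<lambda>y. {g :: nat \<Rightarrow> nat. \<exists>x. g x = y})" for U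
    using that by (auto intro!: open_Collect_ex open_seq_local(1)[of "{_}"])
  show "fixing A = {g. (\<forall>x y. g (x XOR y) = g x XOR g y) \<and> (\<forall>x. v (g x) = v x)} \<inter>
      {g. \<forall>f\<in>A. \<forall>x. f x = f (g x)} \<inter> (\<Inter>y. {g. \<exists>x. g x = y})"
    unfolding fixing_eq aut_eq by blast
qed simp

lemma nowhere_dense_coset:
  assumes h: "h \<in> functionals" and A: "finite A" "A \<subseteq> functionals" and less: "\<gamma> < rk h A"
    and d: "d \<in> functionals"
  shows "nowhere_dense_in (top_of_set (fixing A)) {g \<in> fixing A. r (fadd (h \<circ> finv g) d) \<le> \<gamma>}"
    (is "nowhere_dense_in ?T ?N")
proof -
  \<comment> \<open>Substituting \<open>g x\<close> for the argument removes the inverse; each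
    condition then depends on a single value of \<open>g\<close>, so the set is closed.\<close>
  have "?N = fixing A \<inter> {g. \<forall>x. \<gamma> \<le> v x \<longrightarrow> (h x + d (g x)) mod 2 = 0}"
  proof -
    have "r (fadd (h \<circ> finv g) d) \<le> \<gamma> \<longleftrightarrow> (\<forall>x. \<gamma> \<le> v x \<longrightarrow> (h x + d (g x)) mod 2 = 0)"
      if "g \<in> fixing A" for g
    proof -
      have g: "g \<in> aut" using that by (simp add: fixing_def)
      have surj_all: "(\<forall>y. P y) \<longleftrightarrow> (\<forall>x. P (g x))" for P using aut_inv_f(2)[OF g] by metis
      have "r (fadd (h \<circ> finv g) d) \<le> \<gamma> \<longleftrightarrow> (\<forall>y. \<gamma> \<le> v y \<longrightarrow> (h (finv g y) + d y) mod 2 = 0)"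
        using h d g by (simp add: r_le_iff fadd_functional act_functional) (simp add: fadd_def)
      also have "\<dots> \<longleftrightarrow> (\<forall>x. \<gamma> \<le> v (g x) \<longrightarrow> (h (finv g (g x)) + d (g x)) mod 2 = 0)"
        using surj_all[of "\<lambda>y. \<gamma> \<le> v y \<longrightarrow> (h (finv g y) + d y) mod 2 = 0"] .
      finally show ?thesis using g by (simp add: aut_v)
    qed
    then show ?thesis by blast
  qed
  moreover have "closed {g. \<forall>x. \<gamma> \<le> v x \<longrightarrow> (h x + d (g x)) mod 2 = 0}"
  proof (intro closed_Collect_all)
    show "closed {g. \<gamma> \<le> v x \<longrightarrow> (h x + d (g x)) mod 2 = 0}" for x
      by (rule open_seq_local(2)[of "{x}"]) auto
  qed
  ultimately have "closedin ?T ?N"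
    by (simp only: closedin_closed_Int)
  moreover have "?T interior_of ?N = {}"
  proof (rule ccontr)
    assume "?T interior_of ?N \<noteq> {}"
    then obtain g0 W where W: "openin ?T W" "g0 \<in> W" "W \<subseteq> ?N" by (auto simp: interior_of_def)
    then obtain U where U: "open U" "W = fixing A \<inter> U" by (auto simp: openin_open)
    with W(2) obtain S where S: "finite S" "\<And>g. (\<forall>s\<in>S. g s = g0 s) \<Longrightarrow> g \<in> U"
      using open_seq_iff[of U] by blast
    have "g0 \<in> fixing A" using W U by auto
    from move_off_coset[OF h A less d this S(1)] obtain g
      where "g \<in> fixing A" "\<forall>s\<in>S. g s = g0 s" "\<not> r (fadd (h \<circ> finv g) d) \<le> \<gamma>" by blast
    with S(2) U(2) W(3) show False by blast
  qed
  ultimately show ?thesis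
    by (auto simp: nowhere_dense_in_def closure_of_closedin)
qed

lemma orbit_preimage_eq:
  assumes "h \<in> functionals" "A \<subseteq> functionals" "B \<subseteq> functionals"
  shows "orbit_preimage Aut act [h] A (orbit_over Aut act [h] B) =
    {g \<in> fixing A. \<exists>g'\<in>fixing B. h \<circ> finv g = h \<circ> finv g'}"
  using assms unfolding orbit_preimage_def orbit_over_def
  by (auto simp: pointwise_stabilizer_eq)

text \<open>If the rank drops, the set in question lies in one nowhere dense set. If it does not,
  every \<open>g\<close> outside countably many nowhere dense sets moves \<open>h\<close> to a
  functional with the same invariants over \<open>B\<close>, hence in the same orbit over
  \<open>B\<close>.\<close>

lemma nm_independent_iff:
  assumes h: "h \<in> functionals" and A: "A \<subseteq> B" "finite B" "B \<subseteq> functionals"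
  shows "nm_independent Aut (top_of_set aut) act [h] B A \<longleftrightarrow> rk h B = rk h A"
proof -
  have sub: "A \<subseteq> functionals" "finite A" "A \<union> B = B" using A finite_subset by auto
  let ?T = "top_of_set (fixing A)"
  let ?P = "{g \<in> fixing A. \<exists>g'\<in>fixing B. h \<circ> finv g = h \<circ> finv g'}"
  have "orbit_preimage Aut act [h] A (orbit_over Aut act [h] A) = fixing A"
    using h sub by (auto simp: orbit_preimage_eq)
  moreover have "subtopology (top_of_set aut) (fixing A) = ?T"
    by (auto simp: subtopology_subtopology fixing_def intro!: arg_cong[where f = top_of_set])
  ultimately have indep: "nm_independent Aut (top_of_set aut) act [h] B A \<longleftrightarrow> \<not> meager_in ?T ?P"
    unfolding nm_independent_def using h A sub by (simp add: orbit_preimage_eq)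
  show ?thesis
  proof (cases "rk h B = rk h A")
    case False
    then have less: "rk h B < rk h A" using rk_antimono[OF A(1), of h] by simp
    obtain c where c: "c \<subseteq> B" "r (fadd h (comb id c)) = rk h B" using rk_attained by blast
    have d: "comb id c \<in> functionals" using A(3) c(1) by (rule comb_id_functional)
    \<comment> \<open>An element of the stabilizer of \<open>B\<close> fixes
      \<open>comb id c\<close>, so it preserves the value of \<open>r\<close> that witnesses the
      drop.\<close>
    have "?P \<subseteq> {g \<in> fixing A. r (fadd (h \<circ> finv g) (comb id c)) \<le> rk h B}"
    proof clarify
      fix g g' assume g: "g \<in> fixing A" "g' \<in> fixing B" "h \<circ> finv g = h \<circ> finv g'"
      have "fadd (h \<circ> finv g) (comb id c) = fadd h (comb id c) \<circ> finv g'"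
        unfolding g(3) using comb_id_comp[OF g(2) c(1)] by (simp add: fadd_def fun_eq_iff)
      moreover have "g' \<in> aut" using g(2) by (simp add: fixing_def)
      ultimately show "r (fadd (h \<circ> finv g) (comb id c)) \<le> rk h B"
        using h d c(2) by (simp add: r_act fadd_functional)
    qed
    then have "nowhere_dense_in ?T ?P"
      using nowhere_dense_coset[OF h sub(2,1) less d] unfolding nowhere_dense_in_def
      by (metis (no_types, lifting) closure_of_mono interior_of_mono subset_empty subset_trans)
    then have "meager_in ?T ?P"
      unfolding meager_in_def by (intro exI[of _ "{?P}"]) auto
    with indep False show ?thesis by simp
  next
    case True
    let ?N = "\<lambda>(\<gamma>, c). {g \<in> fixing A. r (fadd (h \<circ> finv g) (comb id c)) \<le> \<gamma>}"
    let ?I = "{..<rk h A} \<times> Pow B"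
    have "countable {..<\<alpha>}" using range_e by (metis countable_image countableI_type)
    then have "countable {..<rk h A}"
      using rk_le_top[OF h, of A] by (auto intro: countable_subset[of _ "{..<\<alpha>}"])
    then have "countable (?N ` ?I)"
      using A(2) by (intro countable_image countable_SIGMA) (auto simp: countable_finite)
    moreover have "nowhere_dense_in ?T N" if "N \<in> ?N ` ?I" for N
      using that nowhere_dense_coset[OF h sub(2,1)] comb_id_functional[OF A(3)] by auto
    moreover have "topspace ?T - \<Union>(?N ` ?I) \<subseteq> ?P"
    proof
      fix g assume "g \<in> topspace ?T - \<Union>(?N ` ?I)"
      then have g: "g \<in> fixing A" and
        gen: "\<And>\<gamma> c. \<gamma> < rk h A \<Longrightarrow> c \<subseteq> B \<Longrightarrow> \<not> r (fadd (h \<circ> finv g) (comb id c)) \<le> \<gamma>" by auto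
      have ga: "g \<in> aut" using g by (simp add: fixing_def)
      let ?h = "h \<circ> finv g"
      have hf: "?h \<in> functionals" using ga h by (rule act_functional)
      have ge: "rk h A \<le> r (fadd ?h (comb id c))" if "c \<subseteq> B" for c
        using gen[of "r (fadd ?h (comb id c))" c] that by (meson not_le order_refl)
      obtain c0 where c0: "c0 \<subseteq> A" "r (fadd h (comb id c0)) = rk h A" using rk_attained by blast
      let ?p = "fadd h (comb id c0)" and ?p' = "fadd ?h (comb id c0)"
      have c0f: "comb id c0 \<in> functionals" using c0(1) sub(1) by (intro comb_id_functional)
      have "?p' = ?p \<circ> finv g"
        using comb_id_comp[OF g c0(1)] by (simp add: fadd_def fun_eq_iff)
      then have rp': "r ?p' = rk h A" using c0(2) h c0f ga by (simp add: r_act fadd_functional)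
      have pf: "?p \<in> functionals" "?p' \<in> functionals" using h hf c0f by (simp_all add: fadd_functional)
      \<comment> \<open>Both sides are \<open>?q\<close> added to a functional of value
        \<open>rk h A\<close>. If \<open>r ?q\<close> is larger, it is the value of both sums;
        otherwise both sums have value at most \<open>rk h A\<close>, and the lower bounds
        \<open>ge'\<close> give equality.\<close>
      have same: "r (fadd h (comb id c)) = r (fadd ?h (comb id c))" if c: "c \<subseteq> B" for c
      proof -
        let ?q = "fadd (comb id c0) (comb id c)"
        have cf: "comb id c \<in> functionals" using A(3) c by (rule comb_id_functional)
        have q: "?q \<in> functionals" using c0f cf by (rule fadd_functional)
        have eq: "fadd f (comb id c) = fadd (fadd f (comb id c0)) ?q" if "f \<in> functionals" for f
          using fadd_cancel[OF that, of "comb id c0"] by (simp only: fadd_assoc flip: fadd_assoc)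
        have ge': "rk h A \<le> r (fadd ?p ?q)" "rk h A \<le> r (fadd ?p' ?q)"
          using rk_le[OF c, of h] ge[OF c] True eq[OF h] eq[OF hf] by simp_all
        show ?thesis
        proof (cases "r ?q \<le> rk h A")
          case le: True
          have "r (fadd ?p ?q) \<le> rk h A" "r (fadd ?p' ?q) \<le> rk h A"
            using r_fadd_le[OF pf(1) q _ le] r_fadd_le[OF pf(2) q _ le] c0(2) rp' by simp_all
          then show ?thesis using ge' unfolding eq[OF h] eq[OF hf] by simp
        next
          case False
          then have "r (fadd ?p ?q) = r ?q" "r (fadd ?p' ?q) = r ?q"
            using pf q c0(2) rp' by (auto intro!: r_fadd_less)
          then show ?thesis unfolding eq[OF h] eq[OF hf] by simp
        qed
      qed
      let ?K = "insert None (Some ` B)"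
      have "\<exists>g'\<in>aut. \<forall>k\<in>?K. case_option h id k \<circ> finv g' = case_option ?h id k"
      proof (rule same_orbit)
        fix c assume c: "c \<subseteq> ?K"
        have fc: "finite c" using A(2) by (intro finite_subset[OF c]) simp
        have "Some -` c \<subseteq> B" using c by auto
        then show "r (comb (case_option h id) c) = r (comb (case_option ?h id) c)"
          using same by (simp add: comb_option[OF fc])
      qed (use A h hf in auto)
      then obtain g' where "g' \<in> aut" "h \<circ> finv g' = ?h" "\<forall>b\<in>B. b \<circ> finv g' = b" by auto
      then have "\<exists>g'\<in>fixing B. h \<circ> finv g = h \<circ> finv g'" by (auto simp: fixing_def)
      with g show "g \<in> ?P" by simp
    qed
    moreover have "topspace ?T \<noteq> {}"
    proof -
      have "id \<in> fixing A" by (auto simp: fixing_def id_aut)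
      then show ?thesis by auto
    qed
    ultimately have "\<not> meager_in ?T ?P"
      by (intro not_meager_if_comeager[OF completely_metrizable_fixing, of A "?N ` ?I"]) auto
    with indep True show ?thesis by simp
  qed
qed

end

section \<open>The compact G-group\<close>

context flag
begin

lemma topological_group_Aut: "topological_group_on Aut (top_of_set aut)"
proof (intro topological_group_on.intro topological_group_on_axioms.intro group_Aut)
  have "continuous_map (prod_topology (top_of_set aut) (top_of_set aut))
    (top_of_set aut) (\<lambda>(g, h). g \<circ> h)"
  proof (rule continuous_map_pair_local)
    fix g h :: "nat \<Rightarrow> nat" and i
    show "\<exists>S T. finite S \<and> finite T \<and> (\<forall>g'\<in>aut. \<forall>h'\<in>aut. (\<forall>s\<in>S. g' s = g s) \<longrightarrow>
      (\<forall>t\<in>T. h' t = h t) \<longrightarrow> (case (g', h') of (g, h) \<Rightarrow> g \<circ> h) i = (case (g, h) of (g, h) \<Rightarrow> g \<circ> h) i)"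
      by (intro exI[of _ "{h i}"] exI[of _ "{i}"]) auto
  qed (auto intro: comp_aut)
  then show "continuous_map (prod_topology (top_of_set aut) (top_of_set aut))
    (top_of_set aut) (\<lambda>(g, h). g \<otimes>\<^bsub>Aut\<^esub> h)" by simp
  have "continuous_on aut (\<lambda>g. finv g i)" for i
  proof (rule continuous_on_locally_constant)
    fix g assume g: "g \<in> aut"
    \<comment> \<open>The inverse at \<open>i\<close> does not change as long as the preimage of
      \<open>i\<close> is still sent to \<open>i\<close>.\<close>
    have "open {g'. g' (finv g i) = g (finv g i)}"
      by (rule open_seq_local(1)[of "{finv g i}"]) auto
    moreover have "finv g' i = finv g i" if "g' \<in> aut" "g' (finv g i) = g (finv g i)" for g'
      using that g by (metis aut_inv_f)
    ultimately show "\<exists>U. open U \<and> g \<in> U \<and> (\<forall>h\<in>U \<inter> aut. finv h i = finv g i)"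
      by (intro exI[of _ "{g'. g' (finv g i) = g (finv g i)}"]) auto
  qed
  then have "continuous_on aut finv" by (rule continuous_on_coordinatewise_then_product)
  then have "continuous_map (top_of_set aut) (top_of_set aut) finv" by (auto simp: inv_aut)
  then show "continuous_map (top_of_set aut) (top_of_set aut) (\<lambda>g. inv\<^bsub>Aut\<^esub> g)"
    by (rule continuous_map_eq) (simp add: inv_Aut)
qed simp

lemma act_comp:
  assumes "g \<in> aut" "h \<in> aut" "f \<in> functionals"
  shows "act (g \<circ> h) f = act g (act h f)"
  using assms by (simp add: finv_o act_functional comp_assoc)

lemma act_finv:
  assumes "g \<in> aut" "f \<in> functionals"
  shows "act (finv g) (act g f) = f" "act g (act (finv g) f) = f"
  using assms by (simp_all add: functional_comp inv_aut fun_eq_iff inv_inv_eq[OF aut_bij])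

lemma act_Bij: "g \<in> aut \<Longrightarrow> act g \<in> Bij functionals"
  unfolding Bij_def
proof
  assume g: "g \<in> aut"
  show "act g \<in> extensional functionals" by (simp add: act_def)
  have "bij_betw (act g) functionals functionals"
    by (rule bij_betw_byWitness[where f' = "act (finv g)"])
      (use act_finv[OF g] in \<open>auto simp: act_functional inv_aut g\<close>)
  then show "act g \<in> {f. bij_betw f functionals functionals}" by simp
qed

lemma faithful_action_act: "faithful_action Aut functionals act"
proof (intro faithful_action.intro group_action.intro group_hom.intro group_hom_axioms.intro
    faithful_action_axioms.intro group_Aut group_BijGroup)
  show "act \<in> hom Aut (BijGroup functionals)"
  proof (rule homI)
    show "act (g \<otimes>\<^bsub>Aut\<^esub> h) = act g \<otimes>\<^bsub>BijGroup functionals\<^esub> act h"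
      if "g \<in> carrier Aut" "h \<in> carrier Aut" for g h
    proof
      fix f
      show "act (g \<otimes>\<^bsub>Aut\<^esub> h) f = (act g \<otimes>\<^bsub>BijGroup functionals\<^esub> act h) f"
        using that act_comp[of g h f] act_Bij[of g] act_Bij[of h]
        by (cases "f \<in> functionals") (simp_all add: BijGroup_def compose_def act_def)
    qed
  qed (simp add: BijGroup_def act_Bij)
  show "inj_on act (carrier Aut)"
  proof (rule inj_onI)
    fix g h assume gh: "g \<in> carrier Aut" "h \<in> carrier Aut" and eq: "act g = act h"
    \<comment> \<open>The coordinate functionals separate vectors.\<close>
    have "bit (finv g x) m = bit (finv h x) m" for x m
    proof -
      have "(parity {m} \<circ> finv g) x = (parity {m} \<circ> finv h) x"
        using fun_cong[OF eq, of "parity {m}"] parity_functional by simp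
      then show ?thesis by (simp add: parity_singleton split: if_splits)
    qed
    then have "finv g = finv h" by (intro ext bit_eqI)
    then show "g = h" using gh by (metis Aut_simps(1) aut_bij inv_inv_eq)
  qed
qed

lemma polish_structure_Aut: "polish_structure Aut (top_of_set aut) functionals act"
proof (intro polish_structure.intro polish_group.intro polish_group_axioms.intro
    topological_group_Aut faithful_action_act polish_structure_axioms.intro)
  show "completely_metrizable_space (top_of_set aut)"
    using completely_metrizable_fixing[of "{}"] by (simp add: fixing_empty)
  show "separable_space (top_of_set aut)" by (rule separable_top_of_set)
  fix f assume f: "f \<in> functionals"
  have eq: "stabilizer Aut act f = fixing {f}"
    using f by (simp add: stabilizer_def fixing_def)
  show "closedin (top_of_set aut) (stabilizer Aut act f)"
    unfolding eq fixing_eq by (rule closedin_closed_Int[OF closed_fixing_condition])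
qed

lemma compact_G_group_Aut:
  "compact_G_group functional_group (top_of_set functionals) Aut (top_of_set aut) act"
proof (intro compact_G_group.intro compact_G_group_axioms.intro topological_group_functionals)
  show "polish_structure Aut (top_of_set aut) (carrier functional_group) act"
    using polish_structure_Aut by simp
  show "compact_space (top_of_set functionals)"
    by (simp add: compact_space_subtopology compact_functionals)
  have "completely_metrizable_space (top_of_set functionals)"
    by (rule completely_metrizable_top_of_set[OF closed_functionals, of "{}"]) auto
  then show "Hausdorff_space (top_of_set functionals)"
    by (intro metrizable_imp_Hausdorff_space completely_metrizable_imp_metrizable_space)
  show "act g \<in> auto functional_group" if "g \<in> carrier Aut" for g
    using that act_Bij
    by (auto simp: auto_def hom_def act_functional fadd_functional) (simp add: fadd_def fun_eq_iff)
  show "continuous_map (prod_topology (top_of_set aut) (top_of_set functionals))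
    (top_of_set functionals) (\<lambda>(g, f). act g f)"
  proof (rule continuous_map_pair_local)
    fix g f :: "nat \<Rightarrow> nat" and i assume g: "g \<in> aut" and f: "f \<in> functionals"
    have "finv g' i = finv g i" if "g' \<in> aut" "g' (finv g i) = g (finv g i)" for g'
      using that g by (metis aut_inv_f)
    then show "\<exists>S T. finite S \<and> finite T \<and> (\<forall>g'\<in>aut. \<forall>f'\<in>functionals. (\<forall>s\<in>S. g' s = g s) \<longrightarrow>
      (\<forall>t\<in>T. f' t = f t) \<longrightarrow> (case (g', f') of (g, f) \<Rightarrow> act g f) i = (case (g, f) of (g, f) \<Rightarrow> act g f) i)"
      using f by (intro exI[of _ "{finv g i}"]) auto
  qed (auto simp: act_functional)
qed

section \<open>Smallness\<close>

lemma small_Aut: "small Aut functionals act"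
  unfolding small_def
proof
  fix n
  let ?E = "{xs. set xs \<subseteq> functionals \<and> length xs = n}" and ?\<Phi> = "\<lambda>g. map (act g)"
  \<comment> \<open>The invariant of a tuple: the value of \<open>r\<close> at every sum of entries,
    a function from a finite set to the countable set of values up to
    \<open>\<alpha>\<close>.\<close>
  let ?t = "\<lambda>xs. restrict (\<lambda>c. r (comb ((!) xs) c)) (Pow {..<n})"
  have sub: "orbit Aut ?\<Phi> ys \<subseteq> orbit Aut ?\<Phi> xs" if xs: "xs \<in> ?E" and ys: "ys \<in> ?E" and eq: "?t xs = ?t ys" for xs ys
  proof -
    have xf: "xs ! k \<in> functionals" and yf: "ys ! k \<in> functionals" if "k \<in> {..<n}" for k
      using xs ys that by (auto simp: subset_iff)
    have "r (comb ((!) xs) c) = r (comb ((!) ys) c)" if "c \<subseteq> {..<n}" for c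
      using fun_cong[OF eq, of c] that by simp
    from same_orbit[OF finite_lessThan xf yf this] obtain g
      where g: "g \<in> aut" "\<forall>k\<in>{..<n}. xs ! k \<circ> finv g = ys ! k" by blast
    then have ys_eq: "ys = ?\<Phi> g xs"
      using xs ys xf by (intro nth_equalityI) auto
    show ?thesis
    proof
      fix zs assume "zs \<in> orbit Aut ?\<Phi> ys"
      then obtain h where h: "h \<in> aut" "zs = ?\<Phi> h ys" by (auto simp: orbit_def)
      have "?\<Phi> h (?\<Phi> g xs) = ?\<Phi> (h \<circ> g) xs"
        unfolding map_map using xs act_comp[OF h(1) g(1)] by (intro map_cong) auto
      then have "zs = ?\<Phi> (h \<circ> g) xs" using h(2) ys_eq by simp
      then show "zs \<in> orbit Aut ?\<Phi> xs" using comp_aut[OF h(1) g(1)] by (auto simp: orbit_def)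
    qed
  qed
  have "countable (orbit Aut ?\<Phi> ` ?E)"
  proof (rule countable_image_factor[of ?t])
    have "countable {..<\<alpha>}" using range_e by (metis countable_image countableI_type)
    moreover have "{..\<alpha>} = insert \<alpha> {..<\<alpha>}" by (auto simp: less_le)
    ultimately have "countable (\<Pi>\<^sub>E c\<in>Pow {..<n}. {..\<alpha>})" by (intro countable_PiE) auto
    moreover have "?t xs \<in> (\<Pi>\<^sub>E c\<in>Pow {..<n}. {..\<alpha>})" if "xs \<in> ?E" for xs
      unfolding restrict_PiE_iff
    proof
      fix c assume "c \<in> Pow {..<n}"
      then have "comb ((!) xs) c \<in> functionals"
        using that by (intro comb_functional) (auto simp: subset_iff)
      then show "r (comb ((!) xs) c) \<in> {..\<alpha>}" by (simp add: r_le_top)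
    qed
    ultimately show "countable (?t ` ?E)" using countable_subset by (metis (no_types, lifting) image_subsetI)
    show "orbit Aut ?\<Phi> xs = orbit Aut ?\<Phi> ys" if "xs \<in> ?E" "ys \<in> ?E" "?t xs = ?t ys" for xs ys
      using sub[OF that] sub[OF that(2,1) that(3)[symmetric]] by (rule antisym[rotated])
  qed
  moreover have "orbits Aut ?E ?\<Phi> = orbit Aut ?\<Phi> ` ?E" by (auto simp: orbits_def)
  ultimately show "countable (orbits Aut ?E ?\<Phi>)" by simp
qed

section \<open>The ascending chain of closed subgroups\<close>

definition K :: "'o \<Rightarrow> (nat \<Rightarrow> nat) set" where
  "K i = {f \<in> functionals. r f \<le> i}"

lemma K_mono: "i \<le> j \<Longrightarrow> K i \<subseteq> K j"
  by (auto simp: K_def)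

lemma subgroup_K: "subgroup (K i) functional_group"
proof
  show "\<one>\<^bsub>functional_group\<^esub> \<in> K i" by (simp add: K_def functional_zero r_le_iff)
qed (auto simp: K_def fadd_functional r_fadd_le inv_functional_group)

lemma K_eq: "K i = functionals \<inter> {f. \<forall>x. i \<le> v x \<longrightarrow> f x = 0}"
  by (auto simp: K_def r_le_iff)

lemma closed_K: "closed (K i)"
  unfolding K_eq
proof (intro closed_Int closed_functionals closed_Collect_all)
  show "closed {f :: nat \<Rightarrow> nat. i \<le> v x \<longrightarrow> f x = 0}" for x
    by (rule open_seq_local(2)[of "{x}"]) auto
qed

lemma empty_closed_K: "empty_closed (top_of_set functionals) Aut act (K i)"
  unfolding empty_closed_def
proof (intro conjI ballI)
  show "closedin (top_of_set functionals) (K i)"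
    using closed_K by (intro closed_subset) (auto simp: K_def)
  fix g assume "g \<in> carrier Aut"
  then have g: "g \<in> aut" by simp
  have sub: "act h ` K i \<subseteq> K i" if "h \<in> aut" for h
    using that by (auto simp: K_def act_functional r_act)
  have "K i \<subseteq> act g ` K i"
  proof
    fix f assume f: "f \<in> K i"
    then have "act (finv g) f \<in> K i" "act g (act (finv g) f) = f"
      using sub[OF inv_aut[OF g]] act_finv(2)[OF g] by (auto simp: K_def)
    then show "f \<in> act g ` K i" by (metis imageI)
  qed
  with sub[OF g] show "act g ` K i = K i" by blast
qed

text \<open>Add to a member of \<open>K i\<close> the coordinate functional of a basis vector of
  level \<open>i\<close> that occurs in none of the finitely many prescribed vectors. The prescribed
  values are kept, the sum stays in \<open>K j\<close> because \<open>i < j\<close>, and it leaves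
  \<open>K i\<close>.\<close>

lemma nowhere_dense_K:
  assumes "i < j" "j \<le> \<alpha>"
  shows "nowhere_dense_in (subtopology (top_of_set functionals) (K j)) (K i)"
proof -
  have "subtopology (top_of_set functionals) (K j) = top_of_set (K j)"
    by (auto simp: subtopology_subtopology K_def intro!: arg_cong[where f = top_of_set])
  moreover have "closedin (top_of_set (K j)) (K i)"
    using closed_K K_mono assms(1) by (intro closed_subset) auto
  moreover have "top_of_set (K j) interior_of K i = {}"
  proof (rule ccontr)
    assume "top_of_set (K j) interior_of K i \<noteq> {}"
    then obtain f W where W: "openin (top_of_set (K j)) W" "f \<in> W" "W \<subseteq> K i"
      by (auto simp: interior_of_def)
    then obtain U where U: "open U" "W = K j \<inter> U" by (auto simp: openin_open)
    with W(2) obtain S where S: "finite S" "\<And>g. (\<forall>s\<in>S. g s = f s) \<Longrightarrow> g \<in> U"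
      using open_seq_iff[of U] by blast
    have f: "f \<in> functionals" "r f \<le> i" "r f \<le> j" using W U(2) by (auto simp: K_def)
    have "\<forall>n. \<exists>m. lev m = i \<and> snd (prod_decode m) = n" using ex_lev[of i] assms by (metis less_le_trans)
    then obtain b where b: "\<And>n. lev (b n) = i" "\<And>n. snd (prod_decode (b n)) = n" by metis
    have "inj b" using b(2) by (metis injI)
    then have "infinite (range b)" by (simp add: finite_image_iff)
    moreover have "finite (\<Union>s\<in>S. bits s)" using S by simp
    ultimately have "\<not> range b \<subseteq> (\<Union>s\<in>S. bits s)" using finite_subset by metis
    then obtain m where m: "lev m = i" "\<And>s. s \<in> S \<Longrightarrow> \<not> bit s m" using b(1) by auto
    let ?p = "parity {m}"
    have pf: "?p \<in> functionals" by (rule parity_functional)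
    have "r ?p \<le> j"
      using m(1) assms(1) pf by (auto simp: r_le_iff parity_singleton le_v_iff dest: leD)
    then have "fadd f ?p \<in> K j" using f pf by (auto simp: K_def fadd_functional intro: r_fadd_le)
    moreover have "fadd f ?p \<in> U"
      using m(2) functional_mod[OF f(1)] by (intro S(2)) (auto simp: fadd_def parity_singleton)
    ultimately have "fadd f ?p \<in> K i" using U(2) W(3) by blast
    then have "fadd f ?p (2 ^ m) = 0" using m(1) f pf by (simp add: K_def r_le_iff fadd_functional v_exp)
    moreover have "f (2 ^ m) = 0" using f m(1) by (simp add: r_le_iff v_exp)
    ultimately show False by (simp add: fadd_def parity_exp)
  qed
  ultimately show ?thesis
    by (auto simp: nowhere_dense_in_def closure_of_closedin K_mono assms(1) less_imp_le)
qed

end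

section \<open>The rank\<close>

text \<open>The levels are taken from the ordinals over the type of the functionals, the type in
  which \<open>nm_rank\<close> takes its values.\<close>

locale ordinal_flag = flag e \<alpha> for e :: "nat \<Rightarrow> (nat \<Rightarrow> nat) ordinal" and \<alpha>
begin

text \<open>Dependence means a strict drop of \<open>rk\<close>, and \<open>rk_drop\<close> provides
  drops that stay above any given smaller ordinal. So \<open>rk\<close> obeys the recursion that
  defines the rank.\<close>

lemma nm_rank_ge_iff_rk:
  assumes "h \<in> functionals" "finite A" "A \<subseteq> functionals"
  shows "nm_rank_ge Aut (top_of_set aut) functionals act \<beta> [h] A \<longleftrightarrow> \<beta> \<le> rk h A"
  using assms(2,3)
proof (induction \<beta> arbitrary: A rule: less_induct)
  case (less \<beta>)
  have "(\<exists>B. finite B \<and> A \<subseteq> B \<and> B \<subseteq> functionals \<and> \<not> nm_independent Aut (top_of_set aut) act [h] B A \<and>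
      nm_rank_ge Aut (top_of_set aut) functionals act \<gamma> [h] B) \<longleftrightarrow> \<gamma> < rk h A" (is "?L \<longleftrightarrow> _")
    if \<gamma>: "\<gamma> < \<beta>" for \<gamma>
  proof
    assume ?L
    then obtain B where B: "finite B" "A \<subseteq> B" "B \<subseteq> functionals"
      "\<not> nm_independent Aut (top_of_set aut) act [h] B A"
      "nm_rank_ge Aut (top_of_set aut) functionals act \<gamma> [h] B" by blast
    have "rk h B \<noteq> rk h A" using nm_independent_iff[OF assms(1) B(2,1,3)] B(4) by blast
    then have "rk h B < rk h A" using rk_antimono[OF B(2), of h] by simp
    moreover have "\<gamma> \<le> rk h B" using less.IH[OF \<gamma> B(1,3)] B(5) by blast
    ultimately show "\<gamma> < rk h A" by (rule le_less_trans[rotated])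
  next
    assume "\<gamma> < rk h A"
    from rk_drop[OF assms(1) less.prems this] obtain B where
      B: "finite B" "A \<subseteq> B" "B \<subseteq> functionals" "rk h B < rk h A" "\<gamma> \<le> rk h B" by blast
    then have "\<not> nm_independent Aut (top_of_set aut) act [h] B A"
      using nm_independent_iff[OF assms(1) B(2,1,3)] by simp
    then show ?L using B less.IH[OF \<gamma> B(1,3)] by blast
  qed
  then show ?case
    by (subst nm_rank_ge_iff) (meson leI less_irrefl less_le_trans)
qed

text \<open>An ordinal above \<open>\<alpha>\<close> exists in the type, so not every ordinal is a
  lower bound and the rank is not \<open>Infinite_Rank\<close>.\<close>

lemma nm_rank_eq:
  assumes "countable {..<\<alpha>}" "h \<in> functionals"
  shows "nm_rank Aut (top_of_set aut) functionals act [h] {} = Rank (r h)"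
proof -
  have le: "Rank \<beta> \<le> nm_rank Aut (top_of_set aut) functionals act [h] {} \<longleftrightarrow> \<beta> \<le> r h" for \<beta>
    using assms(2) by (simp add: le_nm_rank_iff nm_rank_ge_iff_rk rk_empty)
  obtain \<beta> where "\<alpha> < \<beta>" using ex_greater_ordinal[OF assms(1) uncountable_sequences] by blast
  then have "\<not> \<beta> \<le> r h" using r_le_top[OF assms(2)] by (meson leD le_less_trans)
  then have "\<not> Rank \<beta> \<le> nm_rank Aut (top_of_set aut) functionals act [h] {}" using le by simp
  then obtain \<gamma> where "nm_rank Aut (top_of_set aut) functionals act [h] {} = Rank \<gamma>"
    by (cases "nm_rank Aut (top_of_set aut) functionals act [h] {}") auto
  with le[of \<gamma>] le[of "r h"] show ?thesis by simp
qed

lemma structure_nm_rank_eq: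
  assumes "countable {..<\<alpha>}"
  shows "structure_nm_rank Aut (top_of_set aut) functionals act = Rank \<alpha>"
  unfolding structure_nm_rank_def
proof (rule Least_equality)
  show "\<forall>x\<in>functionals. nm_rank Aut (top_of_set aut) functionals act [x] {} \<le> Rank \<alpha>"
    by (simp add: nm_rank_eq[OF assms] r_le_top)
next
  fix \<rho> :: "(nat \<Rightarrow> nat) ordinal rank"
  assume \<rho>: "\<forall>x\<in>functionals. nm_rank Aut (top_of_set aut) functionals act [x] {} \<le> \<rho>"
  \<comment> \<open>A generic functional over the empty set attains the supremum.\<close>
  obtain k where k: "k \<in> functionals" "r k \<le> \<alpha>" "\<alpha> \<le> r (fadd k (comb id {}))"
    using ex_generic_functional[of \<alpha> "{}"] by auto
  then have "r k = \<alpha>" by (simp add: fadd_commute[of k] fadd_zero)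
  with \<rho> k(1) show "Rank \<alpha> \<le> \<rho>" using nm_rank_eq[OF assms k(1)] by auto
qed

end

section \<open>The trivial group\<close>

text \<open>The case of \<open>\<alpha>\<close> zero, with the one-element group acting on itself.
  Its carrier is not meager in itself, so there is no dependence and the rank is the least
  ordinal.\<close>

lemma trivial_witness:
  fixes \<alpha> :: "(nat \<Rightarrow> nat) ordinal"
  assumes bot: "{..<\<alpha>} = {}"
  defines "H \<equiv> singleton_group (\<lambda>_ :: nat. 0 :: nat)"
  defines "T \<equiv> top_of_set (carrier H)" and "\<phi> \<equiv> \<lambda>_. \<lambda>x\<in>carrier H. x"
  shows "compact_G_group H T H T \<phi>" "small H (carrier H) \<phi>"
    "structure_nm_rank H T (carrier H) \<phi> = Rank \<alpha>"
    "comm_group H" "subgroup (carrier H) H" "empty_closed T H \<phi> (carrier H)"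
proof -
  let ?z = "\<lambda>_ :: nat. 0 :: nat"
  have c: "carrier H = {?z}" by (simp add: H_def)
  have grp: "Group.group H" by (simp add: H_def)
  have m: "f \<otimes>\<^bsub>H\<^esub> g = ?z" for f g by (simp add: H_def singleton_group_def)
  have i: "inv\<^bsub>H\<^esub> f = ?z" if "f \<in> carrier H" for f
    using group.inv_closed[OF grp that] c by simp
  show "comm_group H" by (simp add: H_def)
  show "subgroup (carrier H) H" using grp by (rule group.subgroup_self)
  show "empty_closed T H \<phi> (carrier H)"
    by (auto simp: empty_closed_def T_def \<phi>_def)
  have top: "topological_group_on H T"
  proof (intro topological_group_on.intro topological_group_on_axioms.intro grp)
    show "continuous_map (prod_topology T T) T (\<lambda>(x, y). x \<otimes>\<^bsub>H\<^esub> y)"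
      using c by (simp add: m case_prod_unfold T_def)
    have "continuous_map T T (\<lambda>f. ?z)" using c by (simp add: T_def)
    then show "continuous_map T T (\<lambda>f. inv\<^bsub>H\<^esub> f)"
      by (rule continuous_map_eq) (simp add: i T_def)
  qed (simp add: T_def)
  have "closed {f :: nat \<Rightarrow> nat. \<forall>x. f x = 0}"
  proof (intro closed_Collect_all)
    show "closed {f :: nat \<Rightarrow> nat. f x = 0}" for x
      by (rule open_seq_local(2)[of "{x}"]) auto
  qed
  moreover have "{f :: nat \<Rightarrow> nat. \<forall>x. f x = 0} = {?z}" by auto
  ultimately have cm: "completely_metrizable_space T"
    unfolding T_def c by (intro completely_metrizable_top_of_set[of "{?z}" "{}"]) auto
  have act: "faithful_action H (carrier H) \<phi>"
  proof (intro faithful_action.intro group_action.intro group_hom.intro group_hom_axioms.intro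
      faithful_action_axioms.intro grp group_BijGroup)
    show "\<phi> \<in> hom H (BijGroup (carrier H))"
      by (rule homI) (auto simp: BijGroup_def \<phi>_def id_Bij compose_def fun_eq_iff)
    show "inj_on \<phi> (carrier H)" by (simp add: c)
  qed
  show "compact_G_group H T H T \<phi>"
  proof (intro compact_G_group.intro compact_G_group_axioms.intro polish_structure.intro
      polish_group.intro polish_group_axioms.intro polish_structure_axioms.intro top cm act)
    show "separable_space T" unfolding T_def by (rule separable_top_of_set)
    show "compact_space T" by (simp add: T_def c compact_space_subtopology)
    show "Hausdorff_space T"
      using cm by (intro metrizable_imp_Hausdorff_space completely_metrizable_imp_metrizable_space)
    show "closedin T (stabilizer H \<phi> x)" if "x \<in> carrier H" for x
    proof -
      have "stabilizer H \<phi> x = carrier H" using that by (auto simp: stabilizer_def \<phi>_def)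
      then show ?thesis by (simp add: T_def)
    qed
    show "\<phi> g \<in> auto H" for g
      using group.id_in_auto[OF grp] by (simp add: \<phi>_def)
    show "continuous_map (prod_topology T T) T (\<lambda>(g, x). \<phi> g x)"
    proof (rule continuous_map_eq)
      show "continuous_map (prod_topology T T) T (\<lambda>_. ?z)" using c by (simp add: T_def)
    qed (auto simp: T_def \<phi>_def c)
  qed
  show "small H (carrier H) \<phi>"
    unfolding small_def
  proof
    fix n
    have "{xs. set xs \<subseteq> carrier H \<and> length xs = n} \<subseteq> {replicate n ?z}"
      by (auto simp: c intro!: replicate_eqI)
    moreover have "orbits H {xs. set xs \<subseteq> carrier H \<and> length xs = n} (\<lambda>g. map (\<phi> g)) =
      orbit H (\<lambda>g. map (\<phi> g)) ` {xs. set xs \<subseteq> carrier H \<and> length xs = n}"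
      by (auto simp: orbits_def)
    ultimately show "countable (orbits H {xs. set xs \<subseteq> carrier H \<and> length xs = n} (\<lambda>g. map (\<phi> g)))"
      by (metis (no_types, lifting) countable_empty countable_image countable_insert countable_subset)
  qed
  have stab: "pointwise_stabilizer H \<phi> A = carrier H" if "A \<subseteq> carrier H" for A
    using that by (auto simp: pointwise_stabilizer_def \<phi>_def)
  have indep: "nm_independent H T \<phi> [?z] B {}" if "B \<subseteq> carrier H" for B
  proof -
    have map: "map (\<phi> g) [?z] = [?z]" for g by (simp add: \<phi>_def c)
    have "orbit_preimage H \<phi> [?z] {} (orbit_over H \<phi> [?z] B) = carrier H" if "B \<subseteq> carrier H" for B
      using stab[OF that] stab[of "{}"] map c by (auto simp: orbit_preimage_def orbit_over_def)
    then have eq: "orbit_preimage H \<phi> [?z] {} (orbit_over H \<phi> [?z] {}) = carrier H"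
      "orbit_preimage H \<phi> [?z] {} (orbit_over H \<phi> [?z] ({} \<union> B)) = carrier H"
      using that by auto
    have "\<not> meager_in T (carrier H)"
      by (rule not_meager_if_comeager[OF cm, of "{}"]) (auto simp: T_def c)
    then show ?thesis unfolding nm_independent_def eq by (simp add: T_def subtopology_subtopology)
  qed
  have bot_le: "\<alpha> \<le> \<beta>" for \<beta> using bot by (metis empty_iff lessThan_iff not_le)
  have ge: "nm_rank_ge H T (carrier H) \<phi> \<beta> [?z] {} \<longleftrightarrow> \<beta> \<le> \<alpha>" for \<beta>
  proof
    assume ge: "nm_rank_ge H T (carrier H) \<phi> \<beta> [?z] {}"
    show "\<beta> \<le> \<alpha>"
    proof (rule ccontr)
      assume "\<not> \<beta> \<le> \<alpha>"
      then have "\<alpha> < \<beta>" by simp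
      with ge show False using indep by (subst (asm) nm_rank_ge_iff) blast
    qed
  next
    assume "\<beta> \<le> \<alpha>"
    then have "\<not> \<gamma> < \<beta>" for \<gamma> using bot_le[of \<gamma>] by (meson leD le_less_trans not_le order_trans)
    then show "nm_rank_ge H T (carrier H) \<phi> \<beta> [?z] {}" by (subst nm_rank_ge_iff) blast
  qed
  obtain \<beta> where "\<alpha> < \<beta>"
    using ex_greater_ordinal[of \<alpha>] uncountable_sequences bot by (metis countable_empty)
  then have "nm_rank H T (carrier H) \<phi> [?z] {} \<noteq> Infinite_Rank"
    using le_nm_rank_iff[of \<beta> H T "carrier H" \<phi> "[?z]" "{}"] ge[of \<beta>] by auto
  then obtain \<gamma> where g: "nm_rank H T (carrier H) \<phi> [?z] {} = Rank \<gamma>"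
    by (cases "nm_rank H T (carrier H) \<phi> [?z] {}") auto
  then have "\<gamma> = \<alpha>"
    using le_nm_rank_iff[of \<gamma> H T "carrier H" \<phi> "[?z]" "{}"] ge[of \<gamma>] bot_le[of \<gamma>] by simp
  then show "structure_nm_rank H T (carrier H) \<phi> = Rank \<alpha>"
    unfolding structure_nm_rank_def c using g c by (intro Least_equality) auto
qed

text \<open>A countable ordinal is one with countably many predecessors; the ordinals over the type
  of sequences include all of these.\<close>

theorem theorem3p4:
  fixes \<alpha> :: "(nat \<Rightarrow> nat) ordinal"
  assumes "countable {..<\<alpha>}"
  shows "\<exists>(H :: (nat \<Rightarrow> nat) monoid) TH (G :: (nat \<Rightarrow> nat) monoid) TG \<phi>.
    compact_G_group H TH G TG \<phi> \<and>
    small G (carrier H) \<phi> \<and>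
    nm_stable G TG (carrier H) \<phi> \<and>
    structure_nm_rank G TG (carrier H) \<phi> = Rank \<alpha> \<and>
    comm_group H \<and>
    (\<exists>K :: (nat \<Rightarrow> nat) ordinal \<Rightarrow> (nat \<Rightarrow> nat) set.
       (\<forall>i\<le>\<alpha>. subgroup (K i) H \<and> empty_closed TH G \<phi> (K i)) \<and>
       (\<forall>i j. i < j \<and> j \<le> \<alpha> \<longrightarrow>
          K i \<subseteq> K j \<and> nowhere_dense_in (subtopology TH (K j)) (K i)))"
proof (cases "{..<\<alpha>} = {}")
  case True
  note triv = trivial_witness[OF True]
  let ?H = "singleton_group (\<lambda>_ :: nat. 0 :: nat)"
  \<comment> \<open>There are no two indices to compare, so a constant chain suffices.\<close>
  have no: "\<not> (i < j \<and> j \<le> \<alpha>)" for i j using True by (metis empty_iff lessThan_iff less_le_trans)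
  have st: "nm_stable ?H (top_of_set (carrier ?H)) (carrier ?H) (\<lambda>_. \<lambda>x\<in>carrier ?H. x)"
    unfolding nm_stable_def triv(3) by (simp add: less_rank_def)
  show ?thesis
    by (rule exI[of _ ?H], rule exI[of _ "top_of_set (carrier ?H)"], rule exI[of _ ?H],
        rule exI[of _ "top_of_set (carrier ?H)"], rule exI[of _ "\<lambda>_. \<lambda>x\<in>carrier ?H. x"])
      (use triv no st in \<open>blast intro: exI[of _ "\<lambda>_. carrier ?H"]\<close>)
next
  case False
  then obtain e :: "nat \<Rightarrow> (nat \<Rightarrow> nat) ordinal" where "range e = {..<\<alpha>}"
    using assms uncountable_def by blast
  then interpret ordinal_flag e \<alpha> by (simp add: ordinal_flag_def flag_def)
  have rank: "structure_nm_rank Aut (top_of_set aut) functionals act = Rank \<alpha>"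
    using assms by (rule structure_nm_rank_eq)
  have st: "nm_stable Aut (top_of_set aut) functionals act"
    unfolding nm_stable_def rank by (simp add: less_rank_def)
  show ?thesis
  proof (rule exI[of _ functional_group], rule exI[of _ "top_of_set functionals"], rule exI[of _ Aut],
      rule exI[of _ "top_of_set aut"], rule exI[of _ act], intro conjI exI[of _ K] allI impI)
    show "compact_G_group functional_group (top_of_set functionals) Aut (top_of_set aut) act"
      by (rule compact_G_group_Aut)
    show "comm_group functional_group" by (rule comm_group_functional_group)
    show "subgroup (K i) functional_group" for i by (rule subgroup_K)
    show "empty_closed (top_of_set functionals) Aut act (K i)" for i by (rule empty_closed_K)
    show "K i \<subseteq> K j" if "i < j \<and> j \<le> \<alpha>" for i j using that by (intro K_mono) (blast intro: less_imp_le)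
    show "nowhere_dense_in (subtopology (top_of_set functionals) (K j)) (K i)"
      if "i < j \<and> j \<le> \<alpha>" for i j using that nowhere_dense_K by simp
  qed (use small_Aut st rank in simp_all)
qed

end
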